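(* The subsystem $\mathsf{RCA}_0$ of second order arithmetic proves the principle $\mathsf{ERT}$: for every $k\in\mathbb N$ and every function $f:\mathbb N\to k$ there is a $b\in\mathbb N$ such that for all $x\ge b$ there is a $y\ge b$ such that $x\neq y$ and $f(x)=f(y)$.
   Context: $\mathsf{RCA}_0$ is the usual base system of reverse mathematics: basic natural number arithmetic axioms, induction restricted to $\Sigma^0_1$ formulas, and recursive ($\Delta^0_1$) comprehension. The number $k$ is identified with $\{0,\dots,k-1\}$, and functions are (coded by) sets, i.e. second order objects. The principle $\mathsf{ERT}$ is a sentence of second order arithmetic; $k$ ranges over all numbers of the model (not only standard ones). *)

theory Defs
  imports Main
begin

section \<open>The language of second order arithmetic\<close>

text \<open>
  Two-sorted first order language with number terms and set variables. Both sorts use de Bruijn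
  indices, counted independently: \<^term>\<open>AllN\<close> below binds number index 0 and leaves set indices
  alone, \<^term>\<open>AllS\<close> binds set index 0 and leaves number indices alone. Equality is primitive for
  numbers only. The remaining connectives are defined classically.
\<close>

datatype tm =
    Var nat
  | Zero
  | One
  | Plus tm tm
  | Times tm tm

datatype fm =
    Eq tm tm
  | Less tm tm
  | Mem tm nat
  | Fls
  | Imp fm fm
  | AllN fm
  | AllS fm

abbreviation Neg :: "fm \<Rightarrow> fm" where "Neg p \<equiv> Imp p Fls"
abbreviation Or :: "fm \<Rightarrow> fm \<Rightarrow> fm" where "Or p q \<equiv> Imp (Neg p) q"
abbreviation And :: "fm \<Rightarrow> fm \<Rightarrow> fm" where "And p q \<equiv> Neg (Imp p (Neg q))"
abbreviation Iff :: "fm \<Rightarrow> fm \<Rightarrow> fm" where "Iff p q \<equiv> And (Imp p q) (Imp q p)"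
abbreviation ExN :: "fm \<Rightarrow> fm" where "ExN p \<equiv> Neg (AllN (Neg p))"
abbreviation ExS :: "fm \<Rightarrow> fm" where "ExS p \<equiv> Neg (AllS (Neg p))"
abbreviation Leq :: "tm \<Rightarrow> tm \<Rightarrow> fm" where "Leq s t \<equiv> Or (Less s t) (Eq s t)"
abbreviation Succ :: "tm \<Rightarrow> tm" where "Succ t \<equiv> Plus t One"

primrec subst_tm :: "(nat \<Rightarrow> tm) \<Rightarrow> tm \<Rightarrow> tm" where
  "subst_tm \<sigma> (Var i) = \<sigma> i"
| "subst_tm \<sigma> Zero = Zero"
| "subst_tm \<sigma> One = One"
| "subst_tm \<sigma> (Plus s t) = Plus (subst_tm \<sigma> s) (subst_tm \<sigma> t)"
| "subst_tm \<sigma> (Times s t) = Times (subst_tm \<sigma> s) (subst_tm \<sigma> t)"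

abbreviation lift_tm :: "tm \<Rightarrow> tm" where
  "lift_tm \<equiv> subst_tm (\<lambda>i. Var (Suc i))"

text \<open>
  Simultaneous capture-avoiding substitution of number terms \<open>\<sigma>\<close> for number variables and of set
  variables \<open>\<rho>\<close> for set variables.
\<close>

primrec subst :: "(nat \<Rightarrow> tm) \<Rightarrow> (nat \<Rightarrow> nat) \<Rightarrow> fm \<Rightarrow> fm" where
  "subst \<sigma> \<rho> (Eq s t) = Eq (subst_tm \<sigma> s) (subst_tm \<sigma> t)"
| "subst \<sigma> \<rho> (Less s t) = Less (subst_tm \<sigma> s) (subst_tm \<sigma> t)"
| "subst \<sigma> \<rho> (Mem t X) = Mem (subst_tm \<sigma> t) (\<rho> X)"
| "subst \<sigma> \<rho> Fls = Fls"
| "subst \<sigma> \<rho> (Imp p q) = Imp (subst \<sigma> \<rho> p) (subst \<sigma> \<rho> q)"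
| "subst \<sigma> \<rho> (AllN p) = AllN (subst (case_nat (Var 0) (\<lambda>i. lift_tm (\<sigma> i))) \<rho> p)"
| "subst \<sigma> \<rho> (AllS p) = AllS (subst \<sigma> (case_nat 0 (\<lambda>i. Suc (\<rho> i))) p)"

definition liftN :: "fm \<Rightarrow> fm" where
  "liftN = subst (\<lambda>i. Var (Suc i)) (\<lambda>i. i)"

definition liftS :: "fm \<Rightarrow> fm" where
  "liftS = subst Var Suc"

definition instN :: "fm \<Rightarrow> tm \<Rightarrow> fm" where
  "instN p t = subst (case_nat t Var) (\<lambda>i. i) p"

definition instS :: "fm \<Rightarrow> nat \<Rightarrow> fm" where
  "instS p X = subst Var (case_nat X (\<lambda>i. i)) p"


section \<open>Provability\<close>

text \<open>
  A Hilbert calculus for classical two-sorted first order logic with equality. The generalization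
  rules are unrestricted, as in Mendelson's or Shoenfield's textbook, so a non-logical axiom with
  free variables has the force of its universal closure. Lifting a formula expresses that the
  variable bound by the adjacent quantifier does not occur in it.
\<close>

inductive provable :: "fm set \<Rightarrow> fm \<Rightarrow> bool" (infix "\<turnstile>" 50) for T :: "fm set" where
  axiom: "p \<in> T \<Longrightarrow> T \<turnstile> p"
| K: "T \<turnstile> Imp p (Imp q p)"
| S: "T \<turnstile> Imp (Imp p (Imp q r)) (Imp (Imp p q) (Imp p r))"
| DN: "T \<turnstile> Imp (Neg (Neg p)) p"
| AllN_inst: "T \<turnstile> Imp (AllN p) (instN p t)"
| AllN_imp: "T \<turnstile> Imp (AllN (Imp (liftN p) q)) (Imp p (AllN q))"
| AllS_inst: "T \<turnstile> Imp (AllS p) (instS p X)"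
| AllS_imp: "T \<turnstile> Imp (AllS (Imp (liftS p) q)) (Imp p (AllS q))"
| Eq_refl: "T \<turnstile> Eq t t"
| Eq_subst: "T \<turnstile> Imp (Eq s t) (Imp (instN p s) (instN p t))"
| MP: "T \<turnstile> Imp p q \<Longrightarrow> T \<turnstile> p \<Longrightarrow> T \<turnstile> q"
| GenN: "T \<turnstile> p \<Longrightarrow> T \<turnstile> AllN p"
| GenS: "T \<turnstile> p \<Longrightarrow> T \<turnstile> AllS p"


section \<open>The axioms of $\mathsf{RCA}_0$\<close>

text \<open>
  \<open>Delta00\<close>: bounded quantifier formulas, possibly with free number and set variables. The bound is
  a term not containing the quantified variable, hence the lift.
\<close>

inductive Delta00 :: "fm \<Rightarrow> bool" where
  "Delta00 (Eq s t)"
| "Delta00 (Less s t)"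
| "Delta00 (Mem t X)"
| "Delta00 Fls"
| "Delta00 p \<Longrightarrow> Delta00 q \<Longrightarrow> Delta00 (Imp p q)"
| "Delta00 p \<Longrightarrow> Delta00 (AllN (Imp (Less (Var 0) (lift_tm t)) p))"
| "Delta00 p \<Longrightarrow> Delta00 (ExN (And (Less (Var 0) (lift_tm t)) p))"

definition Sigma01 :: "fm \<Rightarrow> bool" where
  "Sigma01 p \<longleftrightarrow> (\<exists>q. Delta00 q \<and> p = ExN q)"

definition Pi01 :: "fm \<Rightarrow> bool" where
  "Pi01 p \<longleftrightarrow> (\<exists>q. Delta00 q \<and> p = AllN q)"

definition basic_axioms :: "fm set" where
  "basic_axioms =
    {Neg (Eq (Succ (Var 0)) Zero),
     Imp (Eq (Succ (Var 0)) (Succ (Var 1))) (Eq (Var 0) (Var 1)),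
     Eq (Plus (Var 0) Zero) (Var 0),
     Eq (Plus (Var 0) (Succ (Var 1))) (Succ (Plus (Var 0) (Var 1))),
     Eq (Times (Var 0) Zero) Zero,
     Eq (Times (Var 0) (Succ (Var 1))) (Plus (Times (Var 0) (Var 1)) (Var 0)),
     Neg (Less (Var 0) Zero),
     Iff (Less (Var 0) (Succ (Var 1))) (Or (Less (Var 0) (Var 1)) (Eq (Var 0) (Var 1)))}"

text \<open>
  The induction variable is number index 0 of \<open>p\<close>; the other free variables are parameters. In the
  induction step the successor is substituted under the quantifier, so index 0 is mapped to its own
  successor and the parameters are unchanged.
\<close>

definition induction_axiom :: "fm \<Rightarrow> fm" where
  "induction_axiom p =
    Imp (And (instN p Zero)
             (AllN (Imp p (subst (case_nat (Succ (Var 0)) (\<lambda>i. Var (Suc i))) (\<lambda>i. i) p))))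
        (AllN p)"

definition comprehension_axiom :: "fm \<Rightarrow> fm \<Rightarrow> fm" where
  "comprehension_axiom p q =
    Imp (AllN (Iff p q)) (ExS (AllN (Iff (Mem (Var 0) 0) (liftS p))))"

definition RCA0 :: "fm set" where
  "RCA0 = basic_axioms
     \<union> {induction_axiom p | p. Sigma01 p}
     \<union> {comprehension_axiom p q | p q. Sigma01 p \<and> Pi01 q}"


section \<open>The principle $\mathsf{ERT}$\<close>

text \<open>The usual pairing of $\mathsf{RCA}_0$: $(i,j) = (i+j)^2+i$.\<close>

abbreviation pair :: "tm \<Rightarrow> tm \<Rightarrow> tm" where
  "pair s t \<equiv> Plus (Times (Plus s t) (Plus s t)) s"

text \<open>
  Set variable 0 codes a function from the natural numbers to $k$, where $k$ is number variable 0: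
  every element of the set is a pair $(i,j)$ with $j<k$, and every $i$ has exactly one $j$.
\<close>

definition function_into :: fm where
  "function_into =
    And (AllN (Imp (Mem (Var 0) 0)
                   (ExN (ExN (And (Less (Var 0) (Var 3))
                                  (Eq (Var 2) (pair (Var 1) (Var 0))))))))
   (And (AllN (ExN (Mem (pair (Var 1) (Var 0)) 0)))
        (AllN (AllN (AllN (Imp (Mem (pair (Var 2) (Var 1)) 0)
                               (Imp (Mem (pair (Var 2) (Var 0)) 0)
                                    (Eq (Var 1) (Var 0))))))))"

text \<open>Number variables 0 and 1 have the same value under the function coded by set variable 0.\<close>

definition same_value :: fm where
  "same_value = ExN (And (Mem (pair (Var 1) (Var 0)) 0) (Mem (pair (Var 2) (Var 0)) 0))"

text \<open>
  The number quantifiers range over $k$, $b$, $x$, $y$, in this order; under the innermost one, $b$,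
  $x$, $y$ are indices 2, 1, 0.
\<close>

definition ERT :: fm where
  "ERT =
    AllN (AllS (Imp function_into
      (ExN (AllN (Imp (Leq (Var 1) (Var 0))
        (ExN (And (Leq (Var 2) (Var 0))
             (And (Neg (Eq (Var 1) (Var 0)))
                  same_value))))))))"

end

theory Submission
  imports Defs "HOL-Library.Countable_Set"
begin

text \<open>
  By a completeness theorem for the calculus it is enough to show that the principle is true in every
  model of \<open>RCA0\<close>, that is, in a possibly nonstandard discretely ordered semiring together with a
  family of sets that is closed under recursive comprehension and for which \<open>\<Sigma>\<^sub>1\<close> induction holds
  (\<open>completeness\<close>, \<open>valid_ERT\<close>).

  The combinatorial idea is the following. Let \<open>f\<close> take values below \<open>k\<close>, and call \<open>x\<close> single in an
  interval \<open>[t, m)\<close> that contains it if its value occurs only once there. A \<open>b\<close> as required is one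
  for which no \<open>[b, m)\<close> has a single point once \<open>m\<close> is large. Choosing \<open>b\<close> by infinitary questions
  about \<open>f\<close> would take induction for \<open>\<Sigma>\<^sub>2\<close> formulas. Instead, look at a stage \<open>m\<close> and run a greedy
  search: start with \<open>t = 0\<close>, and as long as \<open>[t, m)\<close> has a single point, replace \<open>t\<close> by the successor
  of the least one. Let the weight of \<open>[t, m)\<close> be the sum, over all values below \<open>k\<close>, of the number of
  occurrences in \<open>[t, m)\<close>, counted only up to 2. It is at most \<open>2k\<close>, and every step of the search
  lowers it (\<open>weight_next_start\<close>), so after \<open>2k + 1\<close> steps no single point is left (\<open>chain_end\<close>).

  When \<open>m\<close> grows and \<open>t\<close> is fixed, the weight can only grow; if it does not change, neither does any of
  the capped numbers of occurrences, hence neither does the least single point (\<open>next_start_eq\<close>).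
  Therefore the sequence of weights seen during the search grows lexicographically with \<open>m\<close>. Read in
  base \<open>2k + 1\<close> it is a number that is monotone in \<open>m\<close> (\<open>code_mono\<close>) and bounded independently of \<open>m\<close>
  (\<open>code_bounded\<close>). A bounded recursive function attains its maximum by \<open>\<Sigma>\<^sub>1\<close> induction
  (\<open>bounded_max\<close>), and from a stage with maximal code on the search always ends at the same point,
  which is the desired \<open>b\<close> (\<open>repeating_tail\<close>).

  The number of search steps is in general nonstandard. So the weights, the search and the code have to
  be introduced by primitive recursion inside the model, which rests on a coding of finite sets by
  divisibility (\<open>finite_set_code\<close>, \<open>primitive_recursion\<close>).
\<close>

section \<open>Substitution\<close>

abbreviation upN :: "(nat \<Rightarrow> tm) \<Rightarrow> nat \<Rightarrow> tm" where
  "upN \<sigma> \<equiv> case_nat (Var 0) (\<lambda>i. lift_tm (\<sigma> i))"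

abbreviation upS :: "(nat \<Rightarrow> nat) \<Rightarrow> nat \<Rightarrow> nat" where
  "upS \<rho> \<equiv> case_nat 0 (\<lambda>i. Suc (\<rho> i))"

lemma subst_tm_comp: "subst_tm \<sigma> (subst_tm \<tau> t) = subst_tm (\<lambda>i. subst_tm \<sigma> (\<tau> i)) t"
  by (induction t) auto

lemma subst_tm_Var: "subst_tm Var t = t"
  by (induction t) auto

lemma subst_comp:
  "subst \<sigma> \<rho> (subst \<tau> \<pi> p) = subst (\<lambda>i. subst_tm \<sigma> (\<tau> i)) (\<lambda>i. \<rho> (\<pi> i)) p"
proof (induction p arbitrary: \<sigma> \<rho> \<tau> \<pi>)
  case (AllN p)
  have "(\<lambda>i. subst_tm (upN \<sigma>) (upN \<tau> i)) = upN (\<lambda>i. subst_tm \<sigma> (\<tau> i))"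
    by (auto simp: fun_eq_iff subst_tm_comp split: nat.split)
  then show ?case by (simp add: AllN.IH)
next
  case (AllS p)
  have "(\<lambda>i. upS \<rho> (upS \<pi> i)) = upS (\<lambda>i. \<rho> (\<pi> i))"
    by (auto simp: fun_eq_iff split: nat.split)
  then show ?case by (simp add: AllS.IH)
qed (auto simp: subst_tm_comp)

lemma case_nat_id [simp]: "case_nat (Var 0) (\<lambda>i. Var (Suc i)) = Var" "case_nat 0 Suc = (\<lambda>i. i)"
  by (auto simp: fun_eq_iff split: nat.split)

lemma subst_Var [simp]: "subst Var (\<lambda>i. i) p = p"
  by (induction p) (auto simp: subst_tm_Var)

lemma instN_subst: "instN (subst (upN \<sigma>) \<rho> p) t = subst (case_nat t \<sigma>) \<rho> p"
proof -
  have "(\<lambda>i. subst_tm (case_nat t Var) (upN \<sigma> i)) = case_nat t \<sigma>"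
    by (auto simp: fun_eq_iff subst_tm_comp subst_tm_Var split: nat.split)
  then show ?thesis by (simp add: instN_def subst_comp)
qed

lemma instS_subst: "instS (subst \<sigma> (upS \<rho>) p) X = subst \<sigma> (case_nat X \<rho>) p"
proof -
  have "(\<lambda>i. case_nat X (\<lambda>i. i) (upS \<rho> i)) = case_nat X \<rho>"
    by (auto simp: fun_eq_iff split: nat.split)
  then show ?thesis by (simp add: instS_def subst_comp subst_tm_Var)
qed

text \<open>
  Upper bounds for the free indices. Binders are not discounted, so that the same bound serves for a
  quantified formula and its matrix.
\<close>

primrec tm_bound :: "tm \<Rightarrow> nat" where
  "tm_bound (Var i) = Suc i"
| "tm_bound Zero = 0"
| "tm_bound One = 0"
| "tm_bound (Plus s t) = tm_bound s + tm_bound t"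
| "tm_bound (Times s t) = tm_bound s + tm_bound t"

primrec fm_bound :: "fm \<Rightarrow> nat" where
  "fm_bound (Eq s t) = tm_bound s + tm_bound t"
| "fm_bound (Less s t) = tm_bound s + tm_bound t"
| "fm_bound (Mem t X) = tm_bound t + Suc X"
| "fm_bound Fls = 0"
| "fm_bound (Imp p q) = fm_bound p + fm_bound q"
| "fm_bound (AllN p) = fm_bound p"
| "fm_bound (AllS p) = fm_bound p"

lemma subst_tm_agree: "(\<And>i. i < tm_bound t \<Longrightarrow> \<sigma> i = \<sigma>' i) \<Longrightarrow> subst_tm \<sigma> t = subst_tm \<sigma>' t"
  by (induction t) auto

lemma subst_agree:
  "(\<And>i. i < fm_bound p \<Longrightarrow> \<sigma> i = \<sigma>' i) \<Longrightarrow> (\<And>i. i < fm_bound p \<Longrightarrow> \<rho> i = \<rho>' i) \<Longrightarrow>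
     subst \<sigma> \<rho> p = subst \<sigma>' \<rho>' p"
proof (induction p arbitrary: \<sigma> \<sigma>' \<rho> \<rho>')
  case (AllN p)
  have "subst (upN \<sigma>) \<rho> p = subst (upN \<sigma>') \<rho>' p"
    by (rule AllN.IH) (use AllN.prems in \<open>auto split: nat.split\<close>)
  then show ?case by simp
next
  case (AllS p)
  have "subst \<sigma> (upS \<rho>) p = subst \<sigma>' (upS \<rho>') p"
    by (rule AllS.IH) (use AllS.prems in \<open>auto split: nat.split\<close>)
  then show ?case by simp
next
  case (Imp p q)
  have "subst \<sigma> \<rho> p = subst \<sigma>' \<rho>' p" by (rule Imp.IH(1)) (use Imp.prems in auto)
  moreover have "subst \<sigma> \<rho> q = subst \<sigma>' \<rho>' q" by (rule Imp.IH(2)) (use Imp.prems in auto)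
  ultimately show ?case by simp
qed (auto intro: subst_tm_agree)

section \<open>Derivability from finitely many premises\<close>

lemma provable_instN: "T \<turnstile> AllN p \<Longrightarrow> T \<turnstile> instN p t"
  using AllN_inst MP by blast

lemma provable_instS: "T \<turnstile> AllS p \<Longrightarrow> T \<turnstile> instS p X"
  using AllS_inst MP by blast

text \<open>
  Generalizing and instantiating once replaces index 0 and shifts the others down. Doing this \<open>n\<close> times
  from the outside in replaces the first \<open>n\<close> indices simultaneously, since the induction hypothesis
  is applied to the generalization of \<open>p\<close>.
\<close>

lemma provable_subst_upto:
  "T \<turnstile> p \<Longrightarrow> T \<turnstile> subst (\<lambda>i. if i < n then \<sigma> i else Var (i - n)) (\<lambda>i. i) p"
proof (induction n arbitrary: p \<sigma>)
  case (Suc n)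
  have "T \<turnstile> subst (\<lambda>i. if i < n then \<sigma> (Suc i) else Var (i - n)) (\<lambda>i. i) (AllN p)"
    by (rule Suc.IH) (rule GenN[OF Suc.prems])
  then have "T \<turnstile> subst (case_nat (\<sigma> 0) (\<lambda>i. if i < n then \<sigma> (Suc i) else Var (i - n))) (\<lambda>i. i) p"
    using provable_instN[of T "subst (upN (\<lambda>i. if i < n then \<sigma> (Suc i) else Var (i - n))) (\<lambda>i. i) p" "\<sigma> 0"]
    by (simp only: subst.simps instN_subst)
  also have "case_nat (\<sigma> 0) (\<lambda>i. if i < n then \<sigma> (Suc i) else Var (i - n)) =
      (\<lambda>i. if i < Suc n then \<sigma> i else Var (i - Suc n))"
    by (auto simp: fun_eq_iff split: nat.split)
  finally show ?case .
qed simp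

lemma provable_substS_upto:
  "T \<turnstile> p \<Longrightarrow> T \<turnstile> subst Var (\<lambda>i. if i < n then \<rho> i else i - n) p"
proof (induction n arbitrary: p \<rho>)
  case (Suc n)
  have "T \<turnstile> subst Var (\<lambda>i. if i < n then \<rho> (Suc i) else i - n) (AllS p)"
    by (rule Suc.IH) (rule GenS[OF Suc.prems])
  then have "T \<turnstile> subst Var (case_nat (\<rho> 0) (\<lambda>i. if i < n then \<rho> (Suc i) else i - n)) p"
    using provable_instS[of T "subst Var (upS (\<lambda>i. if i < n then \<rho> (Suc i) else i - n)) p" "\<rho> 0"]
    by (simp only: subst.simps instS_subst)
  also have "case_nat (\<rho> 0) (\<lambda>i. if i < n then \<rho> (Suc i) else i - n) =
      (\<lambda>i. if i < Suc n then \<rho> i else i - Suc n)"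
    by (auto simp: fun_eq_iff split: nat.split)
  finally show ?case .
qed simp

text \<open>
  Generalization is unrestricted, so free variables of theorems behave like universally quantified ones,
  and only finitely many of them occur.
\<close>

lemma provable_subst:
  assumes "T \<turnstile> p"
  shows "T \<turnstile> subst \<sigma> \<rho> p"
proof -
  define n where "n = fm_bound p"
  have "T \<turnstile> subst (\<lambda>i. if i < n then \<sigma> i else Var (i - n)) (\<lambda>i. i) p"
    using assms by (rule provable_subst_upto)
  also have "subst (\<lambda>i. if i < n then \<sigma> i else Var (i - n)) (\<lambda>i. i) p = subst \<sigma> (\<lambda>i. i) p"
    by (rule subst_agree) (auto simp: n_def)
  finally have N: "T \<turnstile> subst \<sigma> (\<lambda>i. i) p" .
  define m where "m = fm_bound (subst \<sigma> (\<lambda>i. i) p)"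
  have "T \<turnstile> subst Var (\<lambda>i. if i < m then \<rho> i else i - m) (subst \<sigma> (\<lambda>i. i) p)"
    using N by (rule provable_substS_upto)
  also have "\<dots> = subst Var \<rho> (subst \<sigma> (\<lambda>i. i) p)"
    by (rule subst_agree) (auto simp: m_def)
  also have "\<dots> = subst \<sigma> \<rho> p"
    by (simp add: subst_comp subst_tm_Var)
  finally show ?thesis .
qed

text \<open>
  The head of the list becomes the innermost premise. With this order the deduction theorem, moving the
  head of the list into the conclusion, holds by definition.
\<close>

primrec imps :: "fm list \<Rightarrow> fm \<Rightarrow> fm" where
  "imps [] p = p"
| "imps (a # G) p = imps G (Imp a p)"

lemma provable_I: "T \<turnstile> Imp p p"
  by (meson K S MP)

lemma imps_theorem: "T \<turnstile> p \<Longrightarrow> T \<turnstile> imps G p"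
  by (induction G arbitrary: p) (auto intro: MP[OF K])

lemma imps_MP: "T \<turnstile> imps G (Imp p q) \<Longrightarrow> T \<turnstile> imps G p \<Longrightarrow> T \<turnstile> imps G q"
proof (induction G arbitrary: p q)
  case (Cons a G)
  have "T \<turnstile> imps G (Imp (Imp a (Imp p q)) (Imp (Imp a p) (Imp a q)))"
    by (rule imps_theorem) (rule S)
  then show ?case using Cons by (metis imps.simps(2))
qed (auto intro: MP)

lemma imps_assm: "T \<turnstile> imps (a # G) a"
  by (simp add: imps_theorem provable_I)

lemma imps_weaken: "T \<turnstile> imps G p \<Longrightarrow> T \<turnstile> imps (a # G) p"
  using imps_MP[OF imps_theorem[OF K]] by auto

lemma imps_explode: "T \<turnstile> imps G Fls \<Longrightarrow> T \<turnstile> imps G p"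
  using imps_MP[OF imps_theorem[OF DN], of T G p] imps_MP[OF imps_theorem[OF K], of T G Fls "Neg p"]
  by blast

lemma imps_contr: "T \<turnstile> imps (Neg p # G) Fls \<Longrightarrow> T \<turnstile> imps G p"
  using imps_MP[OF imps_theorem[OF DN]] by auto

lemma imps_GenN: "T \<turnstile> imps (map liftN G) p \<Longrightarrow> T \<turnstile> imps G (AllN p)"
proof (induction G arbitrary: p)
  case (Cons a G)
  then have "T \<turnstile> imps G (AllN (Imp (liftN a) p))" by simp
  then show ?case using imps_MP[OF imps_theorem[OF AllN_imp]] by auto
qed (auto intro: GenN)

lemma imps_GenS: "T \<turnstile> imps (map liftS G) p \<Longrightarrow> T \<turnstile> imps G (AllS p)"
proof (induction G arbitrary: p)
  case (Cons a G)
  then have "T \<turnstile> imps G (AllS (Imp (liftS a) p))" by simp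
  then show ?case using imps_MP[OF imps_theorem[OF AllS_imp]] by auto
qed (auto intro: GenS)

lemma subst_imps: "subst \<sigma> \<rho> (imps G p) = imps (map (subst \<sigma> \<rho>) G) (subst \<sigma> \<rho> p)"
  by (induction G arbitrary: p) auto

lemma bounds_list: "\<exists>n. \<forall>p\<in>set G. fm_bound p \<le> n"
  by (rule exI[of _ "Max (fm_bound ` set G)"]) simp

text \<open>
  An index beyond all bounds serves as a fresh constant. Sending it to index 0 and shifting all other
  indices up turns the premises into their lifts and the instance back into \<open>p\<close>, which is the form
  that the quantifier axiom \<open>AllN_imp\<close> needs.
\<close>

lemma fresh_GenN: "\<exists>v. T \<turnstile> imps G (instN p (Var v)) \<longrightarrow> T \<turnstile> imps G (AllN p)"
proof -
  obtain v where v: "\<forall>q\<in>set (p # G). fm_bound q \<le> v" using bounds_list by blast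
  let ?\<sigma> = "\<lambda>i. if i = v then Var 0 else Var (Suc i)"
  have G: "map (subst ?\<sigma> (\<lambda>i. i)) G = map liftN G"
    using v by (auto simp: liftN_def intro!: subst_agree)
  have "subst ?\<sigma> (\<lambda>i. i) (instN p (Var v)) =
      subst (\<lambda>i. subst_tm ?\<sigma> (case_nat (Var v) Var i)) (\<lambda>i. i) p"
    by (simp add: instN_def subst_comp)
  also have "\<dots> = subst Var (\<lambda>i. i) p"
    by (rule subst_agree) (use v in \<open>auto split: nat.split\<close>)
  finally have p: "subst ?\<sigma> (\<lambda>i. i) (instN p (Var v)) = p" by simp
  show ?thesis
    using provable_subst[of T "imps G (instN p (Var v))" ?\<sigma> "\<lambda>i. i"]
    by (auto simp: subst_imps G p intro!: imps_GenN)
qed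

lemma fresh_GenS: "\<exists>X. T \<turnstile> imps G (instS p X) \<longrightarrow> T \<turnstile> imps G (AllS p)"
proof -
  obtain v where v: "\<forall>q\<in>set (p # G). fm_bound q \<le> v" using bounds_list by blast
  let ?\<rho> = "\<lambda>i. if i = v then 0 else Suc i"
  have G: "map (subst Var ?\<rho>) G = map liftS G"
    using v by (auto simp: liftS_def intro!: subst_agree)
  have "subst Var ?\<rho> (instS p v) = subst Var (\<lambda>i. ?\<rho> (case_nat v (\<lambda>i. i) i)) p"
    by (simp add: instS_def subst_comp)
  also have "\<dots> = subst Var (\<lambda>i. i) p"
    by (rule subst_agree) (use v in \<open>auto split: nat.split\<close>)
  finally have p: "subst Var ?\<rho> (instS p v) = p" by simp
  show ?thesis
    using provable_subst[of T "imps G (instS p v)" Var ?\<rho>]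
    by (auto simp: subst_imps G p intro!: imps_GenS)
qed

section \<open>Maximal consistent sets with witnesses\<close>

instance tm :: countable by countable_datatype
instance fm :: countable by countable_datatype

text \<open>
  A refuted universal formula must also have a refuted instance; these instances make the limit of the
  extensions below a term model.
\<close>

definition decides :: "fm set \<Rightarrow> fm \<Rightarrow> fm list \<Rightarrow> bool" where
  "decides T p G \<longleftrightarrow> T \<turnstile> imps G p \<or>
     T \<turnstile> imps G (Neg p) \<and>
     (\<forall>q. p = AllN q \<longrightarrow> (\<exists>t. T \<turnstile> imps G (Neg (instN q t)))) \<and>
     (\<forall>q. p = AllS q \<longrightarrow> (\<exists>X. T \<turnstile> imps G (Neg (instS q X))))"

text \<open>
  If \<open>p\<close> is not derivable, its negation can be added; if \<open>p\<close> is a quantified formula, so can the negation of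
  an instance at a fresh variable, as otherwise \<open>p\<close> would follow by generalization.
\<close>

lemma decides_extend:
  assumes "\<not> T \<turnstile> imps G Fls"
  shows "\<exists>G'. \<not> T \<turnstile> imps G' Fls \<and> (\<forall>q. T \<turnstile> imps G q \<longrightarrow> T \<turnstile> imps G' q) \<and> decides T p G'"
proof (cases "T \<turnstile> imps G p")
  case True
  then show ?thesis using assms by (auto simp: decides_def)
next
  case False
  then have con: "\<not> T \<turnstile> imps (Neg p # G) Fls" using imps_contr by blast
  have neg: "T \<turnstile> imps (Neg p # G) (Neg p)" by (rule imps_assm)
  show ?thesis
  proof (cases "(\<exists>q. p = AllN q) \<or> (\<exists>q. p = AllS q)")
    case False
    then have "decides T p (Neg p # G)" using neg unfolding decides_def by blast
    then show ?thesis using con imps_weaken by blast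
  next
    case True
    have "\<exists>r. \<not> T \<turnstile> imps (Neg p # G) r \<and>
      (\<forall>q. p = AllN q \<longrightarrow> (\<exists>t. r = instN q t)) \<and> (\<forall>q. p = AllS q \<longrightarrow> (\<exists>X. r = instS q X))"
      using True
    proof (elim disjE exE)
      fix q assume q: "p = AllN q"
      obtain v where "T \<turnstile> imps (Neg p # G) (instN q (Var v)) \<longrightarrow> T \<turnstile> imps (Neg p # G) (AllN q)"
        using fresh_GenN by blast
      then show ?thesis using con neg q imps_MP by (intro exI[of _ "instN q (Var v)"]) blast
    next
      fix q assume q: "p = AllS q"
      obtain v where "T \<turnstile> imps (Neg p # G) (instS q v) \<longrightarrow> T \<turnstile> imps (Neg p # G) (AllS q)"
        using fresh_GenS by blast
      then show ?thesis using con neg q imps_MP by (intro exI[of _ "instS q v"]) blast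
    qed
    then obtain r where r: "\<not> T \<turnstile> imps (Neg p # G) r"
      "\<And>q. p = AllN q \<Longrightarrow> \<exists>t. r = instN q t" "\<And>q. p = AllS q \<Longrightarrow> \<exists>X. r = instS q X" by blast
    let ?G = "Neg r # Neg p # G"
    have "\<not> T \<turnstile> imps ?G Fls" using r imps_contr by blast
    moreover have "T \<turnstile> imps ?G (Neg p)" "T \<turnstile> imps ?G (Neg r)"
      using neg imps_weaken imps_assm by blast+
    moreover have "T \<turnstile> imps ?G q" if "T \<turnstile> imps G q" for q using that imps_weaken by blast
    moreover have "decides T p ?G"
      unfolding decides_def using calculation(2,3) r(2,3) by blast
    ultimately show ?thesis by blast
  qed
qed

text \<open>
  The properties that make membership in \<open>H\<close> a truth definition over the structure of terms.
\<close>

definition henkin :: "fm set \<Rightarrow> fm set \<Rightarrow> bool" where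
  "henkin T H \<longleftrightarrow> (\<forall>p. T \<turnstile> p \<longrightarrow> p \<in> H) \<and> (\<forall>p q. Imp p q \<in> H \<longleftrightarrow> (p \<in> H \<longrightarrow> q \<in> H)) \<and> Fls \<notin> H \<and>
     (\<forall>p. AllN p \<in> H \<longleftrightarrow> (\<forall>t. instN p t \<in> H)) \<and> (\<forall>p. AllS p \<in> H \<longleftrightarrow> (\<forall>X. instS p X \<in> H))"

text \<open>
  Lindenbaum's construction along an enumeration of the formulas: stage \<open>n + 1\<close> decides the \<open>n\<close>-th one,
  and \<open>H\<close> consists of everything derivable at some stage.
\<close>

lemma henkin_extension:
  assumes "\<not> T \<turnstile> p"
  shows "\<exists>H. henkin T H \<and> p \<notin> H"
proof -
  have "\<exists>g. \<forall>n. (\<not> T \<turnstile> imps (g n) Fls \<and> (n = 0 \<longrightarrow> T \<turnstile> imps (g n) (Neg p))) \<and>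
      (\<forall>q. T \<turnstile> imps (g n) q \<longrightarrow> T \<turnstile> imps (g (Suc n)) q) \<and> decides T (from_nat n) (g (Suc n))"
  proof (rule dependent_nat_choice)
    show "\<exists>G. \<not> T \<turnstile> imps G Fls \<and> (0 = 0 \<longrightarrow> T \<turnstile> imps G (Neg p))"
      using assms imps_contr[of T p "[]"] imps_assm[of T "Neg p" "[]"] by (intro exI[of _ "[Neg p]"]) auto
  next
    fix G and n :: nat assume "\<not> T \<turnstile> imps G Fls \<and> (n = 0 \<longrightarrow> T \<turnstile> imps G (Neg p))"
    then show "\<exists>G'. (\<not> T \<turnstile> imps G' Fls \<and> (Suc n = 0 \<longrightarrow> T \<turnstile> imps G' (Neg p))) \<and>
      (\<forall>q. T \<turnstile> imps G q \<longrightarrow> T \<turnstile> imps G' q) \<and> decides T (from_nat n) G'"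
      using decides_extend by auto
  qed
  then obtain g where con: "\<And>n. \<not> T \<turnstile> imps (g n) Fls" and g0: "T \<turnstile> imps (g 0) (Neg p)"
    and step: "\<And>n q. T \<turnstile> imps (g n) q \<Longrightarrow> T \<turnstile> imps (g (Suc n)) q"
    and dec: "\<And>n. decides T (from_nat n) (g (Suc n))" by blast
  define H where "H = {q. \<exists>n. T \<turnstile> imps (g n) q}"
  have mono: "T \<turnstile> imps (g m) q" if "T \<turnstile> imps (g n) q" "n \<le> m" for n m q
    using that(2,1) by (induction rule: dec_induct) (auto intro: step)
  have thms: "q \<in> H" if "T \<turnstile> q" for q using that imps_theorem by (auto simp: H_def)
  have mp: "r \<in> H" if "Imp q r \<in> H" "q \<in> H" for q r
  proof -
    obtain m n where "T \<turnstile> imps (g m) (Imp q r)" "T \<turnstile> imps (g n) q" using \<open>Imp q r \<in> H\<close> \<open>q \<in> H\<close> by (auto simp: H_def)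
    then have "T \<turnstile> imps (g (m + n)) (Imp q r)" "T \<turnstile> imps (g (m + n)) q" by (auto intro: mono)
    then show ?thesis unfolding H_def using imps_MP by blast
  qed
  have fls: "Fls \<notin> H" using con by (auto simp: H_def)
  have dec': "q \<in> H \<or> Neg q \<in> H \<and> (\<forall>r. q = AllN r \<longrightarrow> (\<exists>t. Neg (instN r t) \<in> H)) \<and>
      (\<forall>r. q = AllS r \<longrightarrow> (\<exists>X. Neg (instS r X) \<in> H))" for q
    using dec[of "to_nat q"] unfolding decides_def H_def from_nat_to_nat by blast
  have "Imp q r \<in> H" if "q \<in> H \<longrightarrow> r \<in> H" for q r
  proof (cases "r \<in> H")
    case True
    then show ?thesis using mp thms[OF K] by blast
  next
    case False
    then have "Neg q \<in> H" using that dec' by blast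
    moreover have "T \<turnstile> Imp (Neg q) (Imp q r)"
    proof -
      have "T \<turnstile> imps [q, Neg q] Fls"
        using imps_MP[OF imps_weaken[OF imps_assm] imps_assm] by blast
      then have "T \<turnstile> imps [q, Neg q] r" by (rule imps_explode)
      then show ?thesis by simp
    qed
    ultimately show ?thesis using mp thms by blast
  qed
  moreover have "AllN q \<in> H \<longleftrightarrow> (\<forall>t. instN q t \<in> H)" for q
    using dec'[of "AllN q"] mp thms[OF AllN_inst] fls by blast
  moreover have "AllS q \<in> H \<longleftrightarrow> (\<forall>X. instS q X \<in> H)" for q
    using dec'[of "AllS q"] mp thms[OF AllS_inst] fls by blast
  moreover have "p \<notin> H" using g0 mp fls by (auto simp: H_def)
  ultimately show ?thesis
    using thms mp fls unfolding henkin_def by (intro exI[of _ H]) blast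
qed

section \<open>Structures and completeness\<close>

text \<open>
  Only the range of the set quantifiers is a parameter of its own; numbers range over the whole type.
\<close>

locale so_structure =
  fixes zero :: 'a ("\<zero>") and one :: 'a ("\<one>")
    and plus :: "'a \<Rightarrow> 'a \<Rightarrow> 'a" (infixl "\<oplus>" 65) and times :: "'a \<Rightarrow> 'a \<Rightarrow> 'a" (infixl "\<otimes>" 70)
    and less :: "'a \<Rightarrow> 'a \<Rightarrow> bool" (infix "\<prec>" 50)
    and sets :: "'a set set"
begin

primrec val :: "(nat \<Rightarrow> 'a) \<Rightarrow> tm \<Rightarrow> 'a" where
  "val e (Var i) = e i"
| "val e Zero = \<zero>"
| "val e One = \<one>"
| "val e (Plus s t) = val e s \<oplus> val e t"
| "val e (Times s t) = val e s \<otimes> val e t"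

primrec sat :: "(nat \<Rightarrow> 'a) \<Rightarrow> (nat \<Rightarrow> 'a set) \<Rightarrow> fm \<Rightarrow> bool" where
  "sat e E (Eq s t) \<longleftrightarrow> val e s = val e t"
| "sat e E (Less s t) \<longleftrightarrow> val e s \<prec> val e t"
| "sat e E (Mem t X) \<longleftrightarrow> val e t \<in> E X"
| "sat e E Fls \<longleftrightarrow> False"
| "sat e E (Imp p q) \<longleftrightarrow> (sat e E p \<longrightarrow> sat e E q)"
| "sat e E (AllN p) \<longleftrightarrow> (\<forall>x. sat (case_nat x e) E p)"
| "sat e E (AllS p) \<longleftrightarrow> (\<forall>X\<in>sets. sat e (case_nat X E) p)"

definition valid :: "fm \<Rightarrow> bool" where
  "valid p \<longleftrightarrow> (\<forall>e E. range E \<subseteq> sets \<longrightarrow> sat e E p)"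

end

lemma henkinD:
  assumes "henkin T H"
  shows "T \<turnstile> p \<Longrightarrow> p \<in> H" "Imp p q \<in> H \<longleftrightarrow> (p \<in> H \<longrightarrow> q \<in> H)" "Fls \<notin> H"
    "AllN p \<in> H \<longleftrightarrow> (\<forall>t. instN p t \<in> H)" "AllS p \<in> H \<longleftrightarrow> (\<forall>X. instS p X \<in> H)"
  using assms unfolding henkin_def by auto

lemma henkin_Eq:
  assumes H: "henkin T H"
  shows "Eq t t \<in> H" and "Eq s t \<in> H \<Longrightarrow> instN p s \<in> H \<Longrightarrow> instN p t \<in> H"
  using henkinD(1)[OF H Eq_refl] henkinD(1)[OF H Eq_subst, of s t p] by (auto simp: henkinD(2)[OF H])

lemma henkin_cong:
  assumes H: "henkin T H" and st: "Eq s t \<in> H"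
  shows "Eq t s \<in> H" and "Eq (Plus s u) (Plus t u) \<in> H" and "Eq (Plus u s) (Plus u t) \<in> H"
    and "Eq (Times s u) (Times t u) \<in> H" and "Eq (Times u s) (Times u t) \<in> H"
    and "Eq s u \<in> H \<Longrightarrow> Eq t u \<in> H"
    and "Less s u \<in> H \<Longrightarrow> Less t u \<in> H" and "Less u s \<in> H \<Longrightarrow> Less u t \<in> H"
    and "Mem s X \<in> H \<Longrightarrow> Mem t X \<in> H"
proof -
  note [simp] = instN_def subst_tm_comp subst_tm_Var henkin_Eq(1)[OF H]
  note cong = henkin_Eq(2)[OF H st]
  show "Eq t s \<in> H" using cong[of "Eq (Var 0) (lift_tm s)"] by simp
  show "Eq (Plus s u) (Plus t u) \<in> H"
    using cong[of "Eq (Plus (lift_tm s) (lift_tm u)) (Plus (Var 0) (lift_tm u))"] by simp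
  show "Eq (Plus u s) (Plus u t) \<in> H"
    using cong[of "Eq (Plus (lift_tm u) (lift_tm s)) (Plus (lift_tm u) (Var 0))"] by simp
  show "Eq (Times s u) (Times t u) \<in> H"
    using cong[of "Eq (Times (lift_tm s) (lift_tm u)) (Times (Var 0) (lift_tm u))"] by simp
  show "Eq (Times u s) (Times u t) \<in> H"
    using cong[of "Eq (Times (lift_tm u) (lift_tm s)) (Times (lift_tm u) (Var 0))"] by simp
  show "Eq s u \<in> H \<Longrightarrow> Eq t u \<in> H" using cong[of "Eq (Var 0) (lift_tm u)"] by simp
  show "Less s u \<in> H \<Longrightarrow> Less t u \<in> H" using cong[of "Less (Var 0) (lift_tm u)"] by simp
  show "Less u s \<in> H \<Longrightarrow> Less u t \<in> H" using cong[of "Less (lift_tm u) (Var 0)"] by simp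
  show "Mem s X \<in> H \<Longrightarrow> Mem t X \<in> H" using cong[of "Mem (Var 0) X"] by simp
qed

text \<open>
  The successor is injective on the classes of terms equated by \<open>H\<close> and misses the class of \<open>Zero\<close>,
  which cannot happen on a finite set.
\<close>

lemma henkin_infinite:
  assumes H: "henkin T H" and T: "basic_axioms \<subseteq> T"
  shows "infinite (range (\<lambda>t. {s. Eq t s \<in> H}))" (is "infinite (range ?c)")
proof
  assume fin: "finite (range ?c)"
  have c: "?c s = ?c t \<longleftrightarrow> Eq s t \<in> H" for s t
    using henkin_Eq(1)[OF H] henkin_cong(1,6)[OF H] by blast
  have ax: "subst \<sigma> (\<lambda>i. i) p \<in> H" if "p \<in> basic_axioms" for p \<sigma>
    using that T H provable_subst[OF axiom] unfolding henkin_def by blast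
  have inj: "Eq s t \<in> H" if "Eq (Succ s) (Succ t) \<in> H" for s t
    using ax[of "Imp (Eq (Succ (Var 0)) (Succ (Var 1))) (Eq (Var 0) (Var 1))"
        "case_nat s (case_nat t Var)"] that H
    by (auto simp: basic_axioms_def henkin_def)
  have nz: "Eq (Succ s) Zero \<notin> H" for s
    using ax[of "Neg (Eq (Succ (Var 0)) Zero)" "case_nat s Var"] H
    by (auto simp: basic_axioms_def henkin_def)
  define S where "S = (\<lambda>A. ?c (Succ (SOME t. A = ?c t)))"
  have S: "S (?c t) = ?c (Succ t)" for t
  proof -
    have "?c t = ?c (SOME u. ?c t = ?c u)" by (rule someI) (rule refl)
    then have "Eq t (SOME u. ?c t = ?c u) \<in> H" by (simp only: c)
    then have "Eq (Succ t) (Succ (SOME u. ?c t = ?c u)) \<in> H" by (rule henkin_cong(2)[OF H])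
    then have "?c (Succ t) = ?c (Succ (SOME u. ?c t = ?c u))" by (simp only: c)
    then show ?thesis by (simp add: S_def)
  qed
  have "inj_on S (range ?c)"
  proof (rule inj_onI)
    fix A B assume "A \<in> range ?c" "B \<in> range ?c" and eq: "S A = S B"
    then obtain s t where "A = ?c s" "B = ?c t" by blast
    with eq have "?c (Succ s) = ?c (Succ t)" by (simp only: S)
    then have "?c s = ?c t" using inj by (simp only: c)
    then show "A = B" using \<open>A = ?c s\<close> \<open>B = ?c t\<close> by simp
  qed
  moreover have "S ` range ?c \<subseteq> range ?c"
    using S by auto
  ultimately have "S ` range ?c = range ?c" using fin by (intro endo_inj_surj)
  then have "?c Zero \<in> S ` range ?c" by simp
  then obtain t where "?c Zero = S (?c t)" by blast
  then have "?c Zero = ?c (Succ t)" by (simp only: S)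
  then have "Eq (Succ t) Zero \<in> H" using henkin_cong(1)[OF H] by (simp only: c)
  then show False using nz by blast
qed

text \<open>
  The term model of a Henkin set refutes \<open>p\<close>. Its numbers are classes of terms, of which there are
  countably infinitely many; carrying the structure over to \<open>nat\<close> along a bijection makes the whole
  type the domain, so that quantification over numbers needs no relativization.
\<close>

theorem completeness:
  assumes T: "basic_axioms \<subseteq> T"
    and models: "\<And>zero one plus times less sets.
      sets \<noteq> {} \<Longrightarrow> (\<And>q. q \<in> T \<Longrightarrow> so_structure.valid zero one plus times less sets q) \<Longrightarrow>
      so_structure.valid (zero :: nat) one plus times less sets p"
  shows "T \<turnstile> p"
proof (rule ccontr)
  assume "\<not> T \<turnstile> p"
  then obtain H where H: "henkin T H" and p: "p \<notin> H" using henkin_extension by blast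
  let ?c = "\<lambda>t. {s. Eq t s \<in> H}"
  have c: "?c s = ?c t \<longleftrightarrow> Eq s t \<in> H" for s t
    using henkin_Eq(1)[OF H] henkin_cong(1,6)[OF H] by blast
  define r where "r t = to_nat_on (range ?c) (?c t)" for t
  have bij: "bij_betw (to_nat_on (range ?c)) (range ?c) UNIV"
    by (intro to_nat_on_infinite henkin_infinite[OF H T]) auto
  have r: "r s = r t \<longleftrightarrow> Eq s t \<in> H" for s t
  proof -
    have "r s = r t \<longleftrightarrow> ?c s = ?c t"
      unfolding r_def using bij by (intro inj_on_eq_iff[of _ "range ?c"]) (auto simp: bij_betw_def)
    then show ?thesis by (simp only: c)
  qed
  have surj: "\<exists>t. n = r t" for n
    using bij unfolding bij_betw_def r_def by (metis (no_types, lifting) imageE UNIV_I)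
  define i where "i n = (SOME t. n = r t)" for n
  have ri [simp]: "r (i n) = n" for n using surj[of n] unfolding i_def by (metis (mono_tags, lifting) someI_ex)
  have ir: "Eq (i (r t)) t \<in> H" "Eq t (i (r t)) \<in> H" for t using r ri by metis+
  define pl where "pl m n = r (Plus (i m) (i n))" for m n
  define ti where "ti m n = r (Times (i m) (i n))" for m n
  define le where "le m n \<longleftrightarrow> Less (i m) (i n) \<in> H" for m n
  define st where "st X = {n. Mem (i n) X \<in> H}" for X
  interpret M: so_structure "r Zero" "r One" pl ti le "range st" .
  have pl: "pl (r s) (r t) = r (Plus s t)" for s t
  proof -
    have "Eq (Plus (i (r s)) (i (r t))) (Plus s (i (r t))) \<in> H" by (rule henkin_cong(2)[OF H ir(1)])
    moreover have "Eq (Plus s (i (r t))) (Plus s t) \<in> H" by (rule henkin_cong(3)[OF H ir(1)])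
    ultimately show ?thesis by (simp add: pl_def flip: r)
  qed
  have ti: "ti (r s) (r t) = r (Times s t)" for s t
  proof -
    have "Eq (Times (i (r s)) (i (r t))) (Times s (i (r t))) \<in> H" by (rule henkin_cong(4)[OF H ir(1)])
    moreover have "Eq (Times s (i (r t))) (Times s t) \<in> H" by (rule henkin_cong(5)[OF H ir(1)])
    ultimately show ?thesis by (simp add: ti_def flip: r)
  qed
  have le: "le (r s) (r t) \<longleftrightarrow> Less s t \<in> H" for s t
    using henkin_cong(7,8)[OF H] ir unfolding le_def by blast
  have st: "r t \<in> st X \<longleftrightarrow> Mem t X \<in> H" for t X
    using henkin_cong(9)[OF H] ir unfolding st_def by blast
  have val: "M.val (\<lambda>i. r (\<sigma> i)) t = r (subst_tm \<sigma> t)" for \<sigma> t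
    by (induction t) (auto simp: pl ti)
  have sat: "M.sat (\<lambda>i. r (\<sigma> i)) (\<lambda>X. st (\<rho> X)) q \<longleftrightarrow> subst \<sigma> \<rho> q \<in> H" for \<sigma> \<rho> q
  proof (induction q arbitrary: \<sigma> \<rho>)
    case (AllN q)
    have *: "case_nat (r t) (\<lambda>i. r (\<sigma> i)) = (\<lambda>i. r (case_nat t \<sigma> i))" for t
      by (auto simp: fun_eq_iff split: nat.split)
    have "M.sat (\<lambda>i. r (\<sigma> i)) (\<lambda>X. st (\<rho> X)) (AllN q) \<longleftrightarrow>
        (\<forall>t. M.sat (case_nat (r t) (\<lambda>i. r (\<sigma> i))) (\<lambda>X. st (\<rho> X)) q)"
      by (metis M.sat.simps(6) surj)
    also have "\<dots> \<longleftrightarrow> (\<forall>t. subst (case_nat t \<sigma>) \<rho> q \<in> H)" by (simp only: * AllN.IH)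
    also have "\<dots> \<longleftrightarrow> subst \<sigma> \<rho> (AllN q) \<in> H" using H by (simp add: henkin_def instN_subst)
    finally show ?case .
  next
    case (AllS q)
    have *: "case_nat (st X) (\<lambda>X. st (\<rho> X)) = (\<lambda>i. st (case_nat X \<rho> i))" for X
      by (auto simp: fun_eq_iff split: nat.split)
    have "M.sat (\<lambda>i. r (\<sigma> i)) (\<lambda>X. st (\<rho> X)) (AllS q) \<longleftrightarrow>
        (\<forall>X. M.sat (\<lambda>i. r (\<sigma> i)) (case_nat (st X) (\<lambda>X. st (\<rho> X))) q)" by simp
    also have "\<dots> \<longleftrightarrow> (\<forall>X. subst \<sigma> (case_nat X \<rho>) q \<in> H)" by (simp only: * AllS.IH)
    also have "\<dots> \<longleftrightarrow> subst \<sigma> \<rho> (AllS q) \<in> H" using H by (simp add: henkin_def instS_subst)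
    finally show ?case .
  qed (use H in \<open>auto simp: val r le st henkin_def\<close>)
  have "M.valid q" if q: "q \<in> T" for q
    unfolding M.valid_def
  proof (intro allI impI)
    fix e :: "nat \<Rightarrow> nat" and E :: "nat \<Rightarrow> nat set" assume "range E \<subseteq> range st"
    then have "\<forall>X. \<exists>Y. E X = st Y" by blast
    then obtain \<rho> where "E = (\<lambda>X. st (\<rho> X))" by metis
    moreover have "e = (\<lambda>j. r (i (e j)))" by simp
    moreover have "subst (\<lambda>j. i (e j)) \<rho> q \<in> H"
      using provable_subst[OF axiom[OF q]] H by (auto simp: henkin_def)
    ultimately show "M.sat e E q" using sat by metis
  qed
  then have "M.valid p" by (intro models) auto
  then have "M.sat (\<lambda>i. r (Var i)) (\<lambda>X. st X) p" by (auto simp: M.valid_def)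
  then show False using sat[of Var "\<lambda>X. X"] p by simp
qed

section \<open>Models of the axioms\<close>

abbreviation env_cons :: "'b \<Rightarrow> (nat \<Rightarrow> 'b) \<Rightarrow> nat \<Rightarrow> 'b" (infixr "##" 60) where
  "x ## e \<equiv> case_nat x e"

text \<open>
  The bounded quantifiers of \<open>Delta00\<close>, as opaque constants so that their semantics can be stated as
  rewrite rules.
\<close>

definition BAll :: "tm \<Rightarrow> fm \<Rightarrow> fm" where "BAll t p = AllN (Imp (Less (Var 0) (lift_tm t)) p)"
definition BEx :: "tm \<Rightarrow> fm \<Rightarrow> fm" where "BEx t p = ExN (And (Less (Var 0) (lift_tm t)) p)"

lemma Delta00_intros:
  "Delta00 (Eq s t)" "Delta00 (Less s t)" "Delta00 (Mem t X)" "Delta00 Fls"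
  "Delta00 p \<Longrightarrow> Delta00 q \<Longrightarrow> Delta00 (Imp p q)"
  "Delta00 p \<Longrightarrow> Delta00 (BAll t p)" "Delta00 p \<Longrightarrow> Delta00 (BEx t p)"
  by (simp_all add: BAll_def BEx_def Delta00.intros)

lemma lift_tm_subst: "subst_tm (upN \<sigma>) (lift_tm t) = lift_tm (subst_tm \<sigma> t)"
  by (simp add: subst_tm_comp)

lemma Delta00_subst: "Delta00 p \<Longrightarrow> Delta00 (subst \<sigma> \<rho> p)"
proof (induction arbitrary: \<sigma> \<rho> rule: Delta00.induct)
  case (6 p t)
  have "subst \<sigma> \<rho> (AllN (Imp (Less (Var 0) (lift_tm t)) p)) = BAll (subst_tm \<sigma> t) (subst (upN \<sigma>) \<rho> p)"
    by (simp add: BAll_def lift_tm_subst)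
  then show ?case using 6 Delta00_intros(6) by presburger
next
  case (7 p t)
  have "subst \<sigma> \<rho> (ExN (And (Less (Var 0) (lift_tm t)) p)) = BEx (subst_tm \<sigma> t) (subst (upN \<sigma>) \<rho> p)"
    by (simp add: BEx_def lift_tm_subst)
  then show ?case using 7 Delta00_intros(7) by presburger
qed (auto intro: Delta00_intros)

context so_structure
begin

lemma val_subst: "val e (subst_tm \<sigma> t) = val (\<lambda>i. val e (\<sigma> i)) t"
  by (induction t) auto

lemma val_lift [simp]: "val (x ## e) (lift_tm t) = val e t"
  by (simp add: val_subst)

lemma sat_subst: "sat e E (subst \<sigma> \<rho> p) \<longleftrightarrow> sat (\<lambda>i. val e (\<sigma> i)) (\<lambda>X. E (\<rho> X)) p"
proof (induction p arbitrary: e E \<sigma> \<rho>)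
  case (AllN p)
  have "(\<lambda>i. val (x ## e) (upN \<sigma> i)) = x ## (\<lambda>i. val e (\<sigma> i))" for x
    by (auto simp: fun_eq_iff split: nat.split)
  then show ?case by (simp add: AllN.IH)
next
  case (AllS p)
  have "(\<lambda>i. (X ## E) (upS \<rho> i)) = X ## (\<lambda>i. E (\<rho> i))" for X
    by (auto simp: fun_eq_iff split: nat.split)
  then show ?case by (simp add: AllS.IH)
qed (auto simp: val_subst)

lemma sat_liftN [simp]: "sat (x ## e) E (liftN p) \<longleftrightarrow> sat e E p"
  by (simp add: liftN_def sat_subst)

lemma sat_liftS [simp]: "sat e (X ## E) (liftS p) \<longleftrightarrow> sat e E p"
  by (simp add: liftS_def sat_subst)

lemma sat_instN [simp]: "sat e E (instN p t) \<longleftrightarrow> sat (val e t ## e) E p"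
proof -
  have "(\<lambda>i. val e (case_nat t Var i)) = val e t ## e"
    by (auto simp: fun_eq_iff split: nat.split)
  then show ?thesis by (simp add: instN_def sat_subst)
qed

lemma sat_ExN: "sat e E (ExN p) \<longleftrightarrow> (\<exists>x. sat (x ## e) E p)" by simp
lemma sat_ExS: "sat e E (ExS p) \<longleftrightarrow> (\<exists>X\<in>sets. sat e (X ## E) p)" by simp
lemma sat_And: "sat e E (And p q) \<longleftrightarrow> sat e E p \<and> sat e E q" by simp
lemma sat_Iff: "sat e E (Iff p q) \<longleftrightarrow> (sat e E p \<longleftrightarrow> sat e E q)" by auto

lemma sat_BAll [simp]: "sat e E (BAll t p) \<longleftrightarrow> (\<forall>x. x \<prec> val e t \<longrightarrow> sat (x ## e) E p)"
  by (simp add: BAll_def)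

lemma sat_BEx [simp]: "sat e E (BEx t p) \<longleftrightarrow> (\<exists>x. x \<prec> val e t \<and> sat (x ## e) E p)"
  by (auto simp: BEx_def)

end

locale rca0_model = so_structure +
  assumes sets_nonempty: "sets \<noteq> {}" and RCA0_valid: "p \<in> RCA0 \<Longrightarrow> valid p"
begin

lemma delta1_comp:
  assumes "Delta00 p" "Delta00 q" "range E \<subseteq> sets"
    and "\<And>x. (\<exists>y. sat (y ## x ## e) E p) \<longleftrightarrow> (\<forall>y. sat (y ## x ## e) E q)"
  shows "{x. \<exists>y. sat (y ## x ## e) E p} \<in> sets"
proof -
  have "comprehension_axiom (ExN p) (AllN q) \<in> RCA0"
    using assms(1,2) by (auto simp: RCA0_def Sigma01_def Pi01_def)
  then have "sat e E (comprehension_axiom (ExN p) (AllN q))"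
    using RCA0_valid assms(3) by (auto simp: valid_def)
  then have "\<exists>X\<in>sets. \<forall>x. x \<in> X \<longleftrightarrow> (\<exists>y. sat (y ## x ## e) E p)"
    using assms(4) unfolding comprehension_axiom_def sat.simps(5)[of _ _ "AllN (Iff (ExN p) (AllN q))"]
    unfolding sat_Iff sat_ExS sat.simps(3,6) sat_ExN sat_liftS val.simps nat.case by blast
  then obtain X where "X \<in> sets" "\<forall>x. x \<in> X \<longleftrightarrow> (\<exists>y. sat (y ## x ## e) E p)" by blast
  moreover from this have "X = {x. \<exists>y. sat (y ## x ## e) E p}" by auto
  ultimately show ?thesis by simp
qed

lemma delta0_comp:
  assumes "Delta00 p" "range E \<subseteq> sets"
  shows "{x. sat (x ## e) E p} \<in> sets"
proof -
  have "Delta00 (liftN p)" using assms(1) by (simp add: liftN_def Delta00_subst)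
  then show ?thesis using delta1_comp[of "liftN p" "liftN p" E e] assms(2) by simp
qed

lemma sigma1_induct:
  assumes "Delta00 p" "range E \<subseteq> sets"
    and "\<exists>y. sat (y ## \<zero> ## e) E p"
    and "\<And>x. \<exists>y. sat (y ## x ## e) E p \<Longrightarrow> \<exists>y. sat (y ## (x \<oplus> \<one>) ## e) E p"
  shows "\<exists>y. sat (y ## x ## e) E p"
proof -
  have *: "(\<lambda>i. val (x ## e) (case_nat (Succ (Var 0)) (\<lambda>i. Var (Suc i)) i)) = (x \<oplus> \<one>) ## e" for x
    by (auto simp: fun_eq_iff split: nat.split)
  have "induction_axiom (ExN p) \<in> RCA0"
    using assms(1) by (auto simp: RCA0_def Sigma01_def)
  then have "sat e E (induction_axiom (ExN p))"
    using RCA0_valid assms(2) by (auto simp: valid_def)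
  then have "sat e E (And (instN (ExN p) Zero) (AllN (Imp (ExN p)
      (subst (case_nat (Succ (Var 0)) (\<lambda>i. Var (Suc i))) (\<lambda>i. i) (ExN p))))) \<longrightarrow> sat e E (AllN (ExN p))"
    unfolding induction_axiom_def sat.simps(5)[of _ _ _ "AllN (ExN p)"] .
  then have ind: "sat (\<zero> ## e) E (ExN p) \<and> (\<forall>x. sat (x ## e) E (ExN p) \<longrightarrow> sat ((x \<oplus> \<one>) ## e) E (ExN p)) \<longrightarrow>
      (\<forall>x. sat (x ## e) E (ExN p))"
    unfolding sat_And sat.simps(6) sat.simps(5)[of _ _ "ExN p"] sat_instN sat_subst val.simps * .
  define P where "P = (\<lambda>x. \<exists>y. sat (y ## x ## e) E p)"
  have "P \<zero> \<and> (\<forall>x. P x \<longrightarrow> P (x \<oplus> \<one>)) \<longrightarrow> (\<forall>x. P x)"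
    using ind unfolding sat_ExN P_def .
  moreover have "P \<zero>" using assms(3) unfolding P_def .
  moreover have "P (x \<oplus> \<one>)" if "P x" for x using assms(4)[of x] that unfolding P_def .
  ultimately have "P x" by blast
  then show ?thesis unfolding P_def .
qed

lemma set_induct:
  assumes "X \<in> sets" "\<zero> \<in> X" "\<And>x. x \<in> X \<Longrightarrow> x \<oplus> \<one> \<in> X"
  shows "x \<in> X"
  using sigma1_induct[of "Mem (Var 1) 0" "\<lambda>_. X" "\<lambda>_. x" x] assms by (simp add: Delta00_intros image_subset_iff)

text \<open>
  Formulas without set variables still need some assignment of sets, for which any member of the family
  will do. The predicate \<open>P\<close> is the reading of the formula, which keeps satisfaction out of the induction
  step.
\<close>

lemma delta0_induct:
  fixes e :: "nat \<Rightarrow> 'a"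
  defines "E \<equiv> \<lambda>_ :: nat. SOME X. X \<in> sets"
  assumes "Delta00 p" "\<And>x. P x \<longleftrightarrow> sat (x ## e) E p"
    and "P \<zero>" "\<And>x. P x \<Longrightarrow> P (x \<oplus> \<one>)"
  shows "P x"
proof -
  have "(SOME X. X \<in> sets) \<in> sets" using sets_nonempty by (simp add: some_in_eq)
  then have "{x. sat (x ## e) E p} \<in> sets"
    using assms(2) by (intro delta0_comp) (auto simp: E_def)
  then have "{x. P x} \<in> sets" using assms(3) by simp
  from set_induct[OF this, of x] show ?thesis using assms(4,5) by blast
qed

section \<open>Arithmetic in a model\<close>

lemma basic:
  "x \<oplus> \<one> \<noteq> \<zero>" "x \<oplus> \<one> = y \<oplus> \<one> \<Longrightarrow> x = y" "x \<oplus> \<zero> = x" "x \<oplus> (y \<oplus> \<one>) = x \<oplus> y \<oplus> \<one>"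
  "x \<otimes> \<zero> = \<zero>" "x \<otimes> (y \<oplus> \<one>) = x \<otimes> y \<oplus> x" "\<not> x \<prec> \<zero>"
  "x \<prec> y \<oplus> \<one> \<longleftrightarrow> x \<prec> y \<or> x = y"
proof -
  have ax: "sat (x ## (\<lambda>_. y)) (\<lambda>_. SOME X. X \<in> sets) p" if "p \<in> basic_axioms" for p
    using RCA0_valid[of p] that sets_nonempty unfolding valid_def RCA0_def
    by (auto simp: some_in_eq image_subset_iff)
  note [simp] = basic_axioms_def
  show "x \<oplus> \<one> \<noteq> \<zero>" using ax[of "Neg (Eq (Succ (Var 0)) Zero)"] by simp
  show "x \<oplus> \<one> = y \<oplus> \<one> \<Longrightarrow> x = y"
    using ax[of "Imp (Eq (Succ (Var 0)) (Succ (Var 1))) (Eq (Var 0) (Var 1))"] by simp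
  show "x \<oplus> \<zero> = x" using ax[of "Eq (Plus (Var 0) Zero) (Var 0)"] by simp
  show "x \<oplus> (y \<oplus> \<one>) = x \<oplus> y \<oplus> \<one>"
    using ax[of "Eq (Plus (Var 0) (Succ (Var 1))) (Succ (Plus (Var 0) (Var 1)))"] by simp
  show "x \<otimes> \<zero> = \<zero>" using ax[of "Eq (Times (Var 0) Zero) Zero"] by simp
  show "x \<otimes> (y \<oplus> \<one>) = x \<otimes> y \<oplus> x"
    using ax[of "Eq (Times (Var 0) (Succ (Var 1))) (Plus (Times (Var 0) (Var 1)) (Var 0))"] by simp
  show "\<not> x \<prec> \<zero>" using ax[of "Neg (Less (Var 0) Zero)"] by simp
  show "x \<prec> y \<oplus> \<one> \<longleftrightarrow> x \<prec> y \<or> x = y"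
    using ax[of "Iff (Less (Var 0) (Succ (Var 1))) (Or (Less (Var 0) (Var 1)) (Eq (Var 0) (Var 1)))"]
    unfolding sat_Iff by auto
qed

lemma add_assoc: "a \<oplus> b \<oplus> c = a \<oplus> (b \<oplus> c)"
  by (rule delta0_induct[where x = c and e = "a ## (\<lambda>_. b)" and
        p = "Eq (Plus (Plus (Var 1) (Var 2)) (Var 0)) (Plus (Var 1) (Plus (Var 2) (Var 0)))"])
    (simp_all add: Delta00_intros basic)

lemma add_0_left: "\<zero> \<oplus> a = a"
  by (rule delta0_induct[where x = a and p = "Eq (Plus Zero (Var 0)) (Var 0)"])
    (simp_all add: Delta00_intros basic)

lemma add_1_left: "\<one> \<oplus> a = a \<oplus> \<one>"
  by (rule delta0_induct[where x = a and p = "Eq (Plus One (Var 0)) (Plus (Var 0) One)"])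
    (simp_all add: Delta00_intros basic add_0_left)

lemma add_comm: "a \<oplus> b = b \<oplus> a"
  by (rule delta0_induct[where x = b and e = "\<lambda>_. a" and
        p = "Eq (Plus (Var 1) (Var 0)) (Plus (Var 0) (Var 1))"])
    (simp_all add: Delta00_intros basic add_0_left, simp add: add_assoc add_1_left)

lemma distrib_left: "a \<otimes> (b \<oplus> c) = a \<otimes> b \<oplus> a \<otimes> c"
  by (rule delta0_induct[where x = c and e = "a ## (\<lambda>_. b)" and
        p = "Eq (Times (Var 1) (Plus (Var 2) (Var 0))) (Plus (Times (Var 1) (Var 2)) (Times (Var 1) (Var 0)))"])
    (simp_all add: Delta00_intros basic, simp add: add_assoc)

lemma mult_1_right: "a \<otimes> \<one> = a"
  using basic(6)[of a \<zero>] by (simp add: basic(5) add_0_left)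

lemma mult_assoc: "a \<otimes> b \<otimes> c = a \<otimes> (b \<otimes> c)"
  by (rule delta0_induct[where x = c and e = "a ## (\<lambda>_. b)" and
        p = "Eq (Times (Times (Var 1) (Var 2)) (Var 0)) (Times (Var 1) (Times (Var 2) (Var 0)))"])
    (simp_all add: Delta00_intros basic distrib_left mult_1_right)

lemma mult_0_left: "\<zero> \<otimes> a = \<zero>"
  by (rule delta0_induct[where x = a and p = "Eq (Times Zero (Var 0)) Zero"])
    (simp_all add: Delta00_intros basic)

lemma mult_1_left: "\<one> \<otimes> a = a"
  by (rule delta0_induct[where x = a and p = "Eq (Times One (Var 0)) (Var 0)"])
    (simp_all add: Delta00_intros basic)

lemma succ_mult: "(a \<oplus> \<one>) \<otimes> b = a \<otimes> b \<oplus> b"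
proof (rule delta0_induct[where x = b and e = "\<lambda>_. a" and
        p = "Eq (Times (Plus (Var 1) One) (Var 0)) (Plus (Times (Var 1) (Var 0)) (Var 0))"])
  fix b assume "(a \<oplus> \<one>) \<otimes> b = a \<otimes> b \<oplus> b"
  then have "(a \<oplus> \<one>) \<otimes> (b \<oplus> \<one>) = a \<otimes> b \<oplus> (b \<oplus> a) \<oplus> \<one>" by (simp add: basic(6) add_assoc)
  also have "\<dots> = a \<otimes> (b \<oplus> \<one>) \<oplus> (b \<oplus> \<one>)" by (simp add: basic(6) add_assoc add_comm[of b a])
  finally show "(a \<oplus> \<one>) \<otimes> (b \<oplus> \<one>) = a \<otimes> (b \<oplus> \<one>) \<oplus> (b \<oplus> \<one>)" .
qed (simp_all add: Delta00_intros basic)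

lemma mult_comm: "a \<otimes> b = b \<otimes> a"
  by (rule delta0_induct[where x = b and e = "\<lambda>_. a" and
        p = "Eq (Times (Var 1) (Var 0)) (Times (Var 0) (Var 1))"])
    (simp_all add: Delta00_intros basic succ_mult mult_0_left)

lemma add_cancel: "x \<oplus> a = y \<oplus> a \<longleftrightarrow> x = y"
proof -
  have "x \<oplus> a = y \<oplus> a \<longrightarrow> x = y"
    by (rule delta0_induct[where x = a and e = "x ## (\<lambda>_. y)" and
        p = "Imp (Eq (Plus (Var 1) (Var 0)) (Plus (Var 2) (Var 0))) (Eq (Var 1) (Var 2))"])
      (auto simp: Delta00_intros basic dest: basic(2))
  then show ?thesis by auto
qed

text \<open>
  Left to right is an induction on \<open>y\<close> over a \<open>\<Sigma>\<^sub>1\<close> formula; the implication is moved under the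
  quantifier to give it this form.
\<close>

lemma less_iff: "x \<prec> y \<longleftrightarrow> (\<exists>z. y = x \<oplus> (z \<oplus> \<one>))"
proof
  have "\<exists>z. sat (z ## y ## (\<lambda>_. x)) (\<lambda>_. SOME X. X \<in> sets)
      (Imp (Less (Var 2) (Var 1)) (Eq (Var 1) (Plus (Var 2) (Plus (Var 0) One))))"
  proof (rule sigma1_induct)
    fix y assume "\<exists>z. sat (z ## y ## (\<lambda>_. x)) (\<lambda>_. SOME X. X \<in> sets)
        (Imp (Less (Var 2) (Var 1)) (Eq (Var 1) (Plus (Var 2) (Plus (Var 0) One))))"
    then obtain z where z: "x \<prec> y \<longrightarrow> y = x \<oplus> (z \<oplus> \<one>)" by auto
    consider "\<not> x \<prec> y \<oplus> \<one>" | "x \<prec> y" | "x = y" using basic(8) by blast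
    then have "\<exists>z. x \<prec> y \<oplus> \<one> \<longrightarrow> y \<oplus> \<one> = x \<oplus> (z \<oplus> \<one>)"
    proof cases
      case 2 then show ?thesis using z by (metis basic(4))
    next
      case 3 then show ?thesis by (metis add_0_left)
    qed auto
    then show "\<exists>z. sat (z ## (y \<oplus> \<one>) ## (\<lambda>_. x)) (\<lambda>_. SOME X. X \<in> sets)
        (Imp (Less (Var 2) (Var 1)) (Eq (Var 1) (Plus (Var 2) (Plus (Var 0) One))))" by simp
  qed (use sets_nonempty in \<open>auto simp: Delta00_intros basic some_in_eq\<close>)
  then show "x \<prec> y \<Longrightarrow> \<exists>z. y = x \<oplus> (z \<oplus> \<one>)" by simp
  have "x \<prec> x \<oplus> (z \<oplus> \<one>)" for z
    by (rule delta0_induct[where x = z and e = "\<lambda>_. x" and p = "Less (Var 1) (Plus (Var 1) (Plus (Var 0) One))"])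
      (auto simp: Delta00_intros basic)
  then show "\<exists>z. y = x \<oplus> (z \<oplus> \<one>) \<Longrightarrow> x \<prec> y" by auto
qed

lemma zero_or_succ: "x = \<zero> \<or> (\<exists>y. x = y \<oplus> \<one>)"
proof -
  have "\<zero> \<prec> x \<oplus> \<one>"
    by (rule delta0_induct[where x = x and p = "Less Zero (Plus (Var 0) One)"])
      (auto simp: Delta00_intros basic)
  then show ?thesis using less_iff[of \<zero> x] by (auto simp: basic add_0_left)
qed

lemma less_linear: "x \<prec> y \<or> x = y \<or> y \<prec> x"
proof (rule delta0_induct[where x = x and e = "\<lambda>_. y" and
      p = "Or (Less (Var 0) (Var 1)) (Or (Eq (Var 0) (Var 1)) (Less (Var 1) (Var 0)))"])
  show "\<zero> \<prec> y \<or> \<zero> = y \<or> y \<prec> \<zero>"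
    using zero_or_succ[of y] less_iff[of \<zero> y] add_0_left by auto
next
  fix z assume "z \<prec> y \<or> z = y \<or> y \<prec> z"
  moreover have "z \<oplus> \<one> \<prec> y \<or> z \<oplus> \<one> = y" if zy: "z \<prec> y"
  proof -
    obtain w where w: "y = z \<oplus> (w \<oplus> \<one>)" using zy less_iff by blast
    then have "y = z \<oplus> \<one> \<oplus> w" by (metis add_assoc add_comm)
    then show ?thesis using zero_or_succ[of w] less_iff[of "z \<oplus> \<one>" y] basic(3) by auto
  qed
  ultimately show "z \<oplus> \<one> \<prec> y \<or> z \<oplus> \<one> = y \<or> y \<prec> z \<oplus> \<one>" using basic(8) by blast
qed (auto simp: Delta00_intros)

lemma less_irrefl: "\<not> x \<prec> x"
proof
  assume "x \<prec> x"
  then obtain z where "x = x \<oplus> (z \<oplus> \<one>)" using less_iff by blast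
  then have "\<zero> \<oplus> x = (z \<oplus> \<one>) \<oplus> x" by (metis add_0_left add_comm)
  then show False using add_cancel basic(1) by metis
qed

lemma less_trans: "x \<prec> y \<Longrightarrow> y \<prec> z \<Longrightarrow> x \<prec> z"
  unfolding less_iff by (auto simp: add_assoc) (metis add_assoc)

definition le (infix "\<preceq>" 50) where "x \<preceq> y \<longleftrightarrow> x \<prec> y \<or> x = y"

text \<open>
  Truncated subtraction completes the operations to those of a \<open>linordered_semidom\<close>, whose theory then
  applies to the model.
\<close>

definition minus (infixl "\<ominus>" 65) where "x \<ominus> y = (if y \<preceq> x then THE z. x = y \<oplus> z else \<zero>)"

lemma le_iff: "x \<preceq> y \<longleftrightarrow> (\<exists>z. y = x \<oplus> z)"
  unfolding le_def less_iff by (metis basic(3) zero_or_succ)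

lemma add_minus: "x \<oplus> y \<ominus> x = y"
proof -
  have "(THE z. x \<oplus> y = x \<oplus> z) = y" by (rule the_equality) (metis add_comm add_cancel)+
  then show ?thesis by (auto simp: minus_def le_iff)
qed

lemma minus_eq_zero: "\<not> y \<preceq> x \<Longrightarrow> x \<ominus> y = \<zero>"
  by (simp add: minus_def)

lemma zero_minus: "\<zero> \<ominus> x = \<zero>"
  using add_minus[of x \<zero>] basic(3) zero_or_succ[of x] by (cases "x = \<zero>") (auto simp: minus_def le_def basic)

lemma add_less_mono: "x \<prec> y \<longleftrightarrow> z \<oplus> x \<prec> z \<oplus> y"
proof -
  have "y = x \<oplus> w \<longleftrightarrow> z \<oplus> y = z \<oplus> x \<oplus> w" for w
    using add_cancel add_comm add_assoc by metis
  then show ?thesis by (simp add: less_iff)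
qed

lemma mult_less_mono:
  assumes "x \<prec> y" "\<zero> \<prec> z"
  shows "z \<otimes> x \<prec> z \<otimes> y"
proof -
  obtain v w where "y = x \<oplus> (v \<oplus> \<one>)" and z: "z = w \<oplus> \<one>"
    using assms less_iff[of x y] less_iff[of \<zero> z] by (auto simp: add_0_left)
  then have "z \<otimes> y = z \<otimes> x \<oplus> (z \<otimes> v \<oplus> z)" by (simp add: distrib_left mult_1_right)
  also have "\<dots> = z \<otimes> x \<oplus> (z \<otimes> v \<oplus> w \<oplus> \<one>)" unfolding z by (simp add: basic(4))
  finally show ?thesis using less_iff by blast
qed

lemma zero_less_iff: "\<zero> \<prec> x \<longleftrightarrow> x \<noteq> \<zero>"
  using zero_or_succ[of x] less_irrefl less_iff[of \<zero> x] by (auto simp: add_0_left basic)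

sublocale arith: linordered_semidom
  where times = times and one = one and plus = plus and zero = zero and minus = minus
    and less_eq = le and less = less
proof
  fix a b c
  show "a \<oplus> b \<oplus> c = a \<oplus> (b \<oplus> c)" by (rule add_assoc)
  show "a \<oplus> b = b \<oplus> a" by (rule add_comm)
  show "a \<oplus> b \<ominus> a = b" by (rule add_minus)
  show "a \<ominus> b \<ominus> c = a \<ominus> (b \<oplus> c)"
  proof (cases "b \<preceq> a")
    case True
    then obtain d where a: "a = b \<oplus> d" using le_iff by blast
    show ?thesis
    proof (cases "c \<preceq> d")
      case True
      then obtain e where "d = c \<oplus> e" using le_iff by blast
      then show ?thesis using a by (metis add_minus add_assoc)
    next
      case False
      then have "\<not> b \<oplus> c \<preceq> a"
        using a add_cancel add_comm add_assoc unfolding le_iff by metis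
      then show ?thesis using a False by (simp add: add_minus minus_eq_zero)
    qed
  next
    case False
    then have "\<not> b \<oplus> c \<preceq> a" unfolding le_iff by (metis add_assoc)
    then show ?thesis using False by (simp add: minus_eq_zero zero_minus)
  qed
  show "(a \<prec> b) = (a \<preceq> b \<and> \<not> b \<preceq> a)" using less_irrefl less_trans unfolding le_def by blast
  show "a \<preceq> a" by (simp add: le_def)
  show "a \<preceq> b \<Longrightarrow> b \<preceq> c \<Longrightarrow> a \<preceq> c" using less_trans unfolding le_def by blast
  show "a \<preceq> b \<Longrightarrow> b \<preceq> a \<Longrightarrow> a = b" using less_trans less_irrefl unfolding le_def by blast
  show "a \<preceq> b \<Longrightarrow> c \<oplus> a \<preceq> c \<oplus> b" using add_less_mono[of a b c] unfolding le_def by blast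
  show "a \<preceq> b \<or> b \<preceq> a" using less_linear unfolding le_def by blast
  show "\<zero> \<oplus> a = a" by (rule add_0_left)
  show "a \<otimes> b \<otimes> c = a \<otimes> (b \<otimes> c)" by (rule mult_assoc)
  show "a \<otimes> b = b \<otimes> a" by (rule mult_comm)
  show "(a \<oplus> b) \<otimes> c = a \<otimes> c \<oplus> b \<otimes> c" by (metis mult_comm distrib_left)
  show "\<zero> \<otimes> a = \<zero>" by (rule mult_0_left)
  show "a \<otimes> \<zero> = \<zero>" by (rule basic)
  show "a \<prec> b \<Longrightarrow> \<zero> \<prec> c \<Longrightarrow> c \<otimes> a \<prec> c \<otimes> b" by (rule mult_less_mono)
  show "\<one> \<otimes> a = a" by (rule mult_1_left)
  show "\<zero> \<noteq> \<one>" using basic(1)[of \<zero>] by (simp add: add_0_left)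
  show "a \<otimes> (b \<ominus> c) = a \<otimes> b \<ominus> a \<otimes> c"
  proof (cases "c \<preceq> b")
    case True
    then obtain d where "b = c \<oplus> d" using le_iff by blast
    then show ?thesis by (simp add: distrib_left add_minus)
  next
    case False
    show ?thesis
    proof (cases "a = \<zero>")
      case True
      then show ?thesis by (simp add: mult_0_left zero_minus)
    next
      case nz: False
      have "b \<prec> c" using False less_linear unfolding le_def by blast
      then have "a \<otimes> b \<prec> a \<otimes> c" using nz by (simp add: mult_less_mono zero_less_iff)
      then have "\<not> a \<otimes> c \<preceq> a \<otimes> b" using less_trans less_irrefl unfolding le_def by metis
      then show ?thesis using False by (simp add: minus_eq_zero basic)
    qed
  qed
  show "a \<otimes> (b \<oplus> c) = a \<otimes> b \<oplus> a \<otimes> c" by (rule distrib_left)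
  show "a \<noteq> \<zero> \<Longrightarrow> b \<noteq> \<zero> \<Longrightarrow> a \<otimes> b \<noteq> \<zero>"
    using mult_less_mono[of \<zero> b a] by (simp add: zero_less_iff basic)
  show "\<zero> \<prec> \<one>" using basic(1)[of \<zero>] by (simp add: zero_less_iff add_0_left)
  show "b \<preceq> a \<Longrightarrow> a \<ominus> b \<oplus> b = a" unfolding le_iff using add_minus add_comm by metis
qed

lemma zero_le [simp]: "\<zero> \<preceq> x"
  by (simp add: le_iff add_0_left)

lemma less_succ: "x \<prec> y \<oplus> \<one> \<longleftrightarrow> x \<preceq> y"
  by (simp add: basic(8) le_def)

lemma succ_le: "x \<oplus> \<one> \<preceq> y \<longleftrightarrow> x \<prec> y"
  using less_succ[of y x] arith.not_less by blast

section \<open>Recursive sets and functions\<close>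

text \<open>
  The semantic counterpart of \<open>pair\<close>. It is injective because the pairs with \<open>x + y = s\<close> have values
  in the interval from \<open>s\<^sup>2\<close> to \<open>s\<^sup>2 + s\<close>, below \<open>(s + 1)\<^sup>2\<close>. It is not onto; the projections
  are 0 outside its range.
\<close>

definition pr :: "'a \<Rightarrow> 'a \<Rightarrow> 'a" where "pr x y = (x \<oplus> y) \<otimes> (x \<oplus> y) \<oplus> x"

lemma le_square: "x \<preceq> x \<otimes> x"
proof (cases "x = \<zero>")
  case False
  then obtain w where "x = w \<oplus> \<one>" using zero_or_succ by blast
  then have "x \<otimes> x = x \<oplus> w \<otimes> x" by (simp add: algebra_simps)
  then show ?thesis by (simp add: le_iff)
qed simp

lemma le_pr: "x \<preceq> pr x y" "y \<preceq> pr x y"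
proof -
  show "x \<preceq> pr x y" by (simp add: pr_def)
  have "y \<preceq> x \<oplus> y" by simp
  also have "\<dots> \<preceq> (x \<oplus> y) \<otimes> (x \<oplus> y)" by (rule le_square)
  also have "\<dots> \<preceq> pr x y" by (simp add: pr_def)
  finally show "y \<preceq> pr x y" .
qed

lemma pr_less:
  assumes "x \<oplus> y \<prec> x' \<oplus> y'"
  shows "pr x y \<prec> pr x' y'"
proof -
  let ?s = "x \<oplus> y"
  have "?s \<oplus> \<one> \<preceq> x' \<oplus> y'" using assms by (simp add: succ_le)
  then have "(?s \<oplus> \<one>) \<otimes> (?s \<oplus> \<one>) \<preceq> (x' \<oplus> y') \<otimes> (x' \<oplus> y')"
    by (intro arith.mult_mono) auto
  moreover have "(?s \<oplus> \<one>) \<otimes> (?s \<oplus> \<one>) = pr x y \<oplus> (?s \<oplus> y) \<oplus> \<one>"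
    by (simp add: pr_def algebra_simps)
  moreover have "pr x y \<prec> pr x y \<oplus> (?s \<oplus> y) \<oplus> \<one>" by (simp add: less_succ)
  moreover have "(x' \<oplus> y') \<otimes> (x' \<oplus> y') \<preceq> pr x' y'" by (simp add: pr_def)
  ultimately show ?thesis by (metis arith.order.strict_trans1 arith.order.strict_trans2)
qed

lemma pr_inject [simp]: "pr x y = pr x' y' \<longleftrightarrow> x = x' \<and> y = y'"
proof
  assume eq: "pr x y = pr x' y'"
  then have s: "x \<oplus> y = x' \<oplus> y'"
    using pr_less[of x y x' y'] pr_less[of x' y' x y] less_linear by (metis less_irrefl)
  then have "x = x'" using eq by (simp add: pr_def)
  then show "x = x' \<and> y = y'" using s by simp
qed simp

lemma pr_mono: "x \<preceq> x' \<Longrightarrow> y \<preceq> y' \<Longrightarrow> pr x y \<preceq> pr x' y'"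
  unfolding pr_def by (intro arith.add_mono arith.mult_mono) auto

definition p1 :: "'a \<Rightarrow> 'a" where "p1 z = (if \<exists>x y. z = pr x y then THE x. \<exists>y. z = pr x y else \<zero>)"
definition p2 :: "'a \<Rightarrow> 'a" where "p2 z = (if \<exists>x y. z = pr x y then THE y. \<exists>x. z = pr x y else \<zero>)"

lemma p1_pr [simp]: "p1 (pr x y) = x" by (auto simp: p1_def)
lemma p2_pr [simp]: "p2 (pr x y) = y" by (auto simp: p2_def)

declare pr_def [symmetric, simp]

text \<open>
  Recursiveness relative to the model: the sets of the family, and the functions whose graph belongs to
  it. Binary predicates and functions are treated as unary ones on pairs, through the projections.
\<close>

definition rec :: "('a \<Rightarrow> bool) \<Rightarrow> bool" where "rec P \<longleftrightarrow> {x. P x} \<in> sets"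

definition graph :: "('a \<Rightarrow> 'a) \<Rightarrow> 'a set" where "graph F = {z. \<exists>x. z = pr x (F x)}"

definition recf :: "('a \<Rightarrow> 'a) \<Rightarrow> bool" where "recf F \<longleftrightarrow> graph F \<in> sets"

lemma pr_in_graph [simp]: "pr x y \<in> graph F \<longleftrightarrow> F x = y"
  by (auto simp: graph_def)

text \<open>
  Both the graph and its complement have to be \<open>\<Sigma>\<^sub>1\<close>. Unpairing the argument takes only bounded
  quantifiers, so the two formulas given for the relation \<open>F x = y\<close> can be used for the graph.
\<close>

lemma recf_delta1:
  assumes p: "Delta00 p" and q: "Delta00 q" and E: "range E \<subseteq> sets"
    and sat: "\<And>x y. F x = y \<longleftrightarrow> (\<exists>w. sat (w ## y ## x ## e) E p)"
      "\<And>x y. F x = y \<longleftrightarrow> (\<forall>w. sat (w ## y ## x ## e) E q)"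
  shows "recf F"
proof -
  define \<sigma> where "\<sigma> = case_nat (Var 2) (case_nat (Var 0) (case_nat (Var 1) (\<lambda>i. Var (Suc (Suc (Suc (Suc i)))))))"
  define D where "D r = BEx (Succ (Var 1)) (BEx (Succ (Var 2))
    (And (Eq (Var 3) (pair (Var 1) (Var 0))) (subst \<sigma> (\<lambda>i. i) r)))" for r
  have \<sigma>: "(\<lambda>i. val (y ## x ## w ## z ## e) (\<sigma> i)) = w ## y ## x ## e" for x y w z
    by (auto simp: fun_eq_iff \<sigma>_def split: nat.split)
  have D: "sat (w ## z ## e) E (D r) \<longleftrightarrow> (\<exists>x y. z = pr x y \<and> sat (w ## y ## x ## e) E r)" for w z r
    by (auto simp: D_def less_succ sat_subst \<sigma> le_pr)
  have DD: "Delta00 (D r)" if "Delta00 r" for r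
    unfolding D_def by (intro Delta00_intros Delta00_subst that)
  have "(\<exists>w. sat (w ## z ## e) E (D p)) \<longleftrightarrow> z \<in> graph F" for z
    unfolding D graph_def mem_Collect_eq using sat(1) by metis
  moreover have "(\<forall>w. sat (w ## z ## e) E (D q)) \<longleftrightarrow> z \<in> graph F" for z
  proof
    assume *: "\<forall>w. sat (w ## z ## e) E (D q)"
    then obtain x y where z: "z = pr x y" unfolding D by blast
    then have "\<forall>w. sat (w ## y ## x ## e) E q" using * unfolding D by simp
    then show "z \<in> graph F" using sat(2) z by simp
  qed (use sat(2) in \<open>unfold D graph_def, blast\<close>)
  ultimately show ?thesis
    using delta1_comp[OF DD[OF p] DD[OF q] E, of e] unfolding recf_def by simp
qed

lemma recf_delta0:
  assumes p: "Delta00 p" and E: "range E \<subseteq> sets"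
    and sat: "\<And>x y. F x = y \<longleftrightarrow> sat (y ## x ## e) E p"
  shows "recf F"
proof (rule recf_delta1)
  show "Delta00 (liftN p)" "Delta00 (liftN p)" using p by (simp_all add: liftN_def Delta00_subst)
  show "F x = y \<longleftrightarrow> (\<exists>w. sat (w ## y ## x ## e) E (liftN p))"
    "F x = y \<longleftrightarrow> (\<forall>w. sat (w ## y ## x ## e) E (liftN p))" for x y
    using sat by simp_all
qed (rule E)

lemma recf_const: "recf (\<lambda>x. c)"
  by (rule recf_delta0[where p = "Eq (Var 0) (Var 2)" and e = "\<lambda>_. c" and E = "\<lambda>_. SOME X. X \<in> sets"])
    (use sets_nonempty in \<open>auto simp: Delta00_intros some_in_eq\<close>)

lemma recf_id: "recf (\<lambda>x. x)"
  by (rule recf_delta0[where p = "Eq (Var 0) (Var 1)" and E = "\<lambda>_. SOME X. X \<in> sets"])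
    (use sets_nonempty in \<open>auto simp: Delta00_intros some_in_eq\<close>)

lemma recf_comp:
  assumes "recf F" "recf G"
  shows "recf (\<lambda>x. F (G x))"
  by (rule recf_delta1[where E = "graph G ## (\<lambda>_. graph F)" and
        p = "And (Mem (pair (Var 2) (Var 0)) 0) (Mem (pair (Var 0) (Var 1)) 1)" and
        q = "Imp (Mem (pair (Var 2) (Var 0)) 0) (Mem (pair (Var 0) (Var 1)) 1)"])
    (use assms in \<open>auto simp: Delta00_intros recf_def split: nat.splits\<close>)

lemma recf_pr:
  assumes "recf F" "recf G"
  shows "recf (\<lambda>x. pr (F x) (G x))"
  by (rule recf_delta1[where E = "graph F ## (\<lambda>_. graph G)" and
        p = "And (Mem (pair (Var 2) (Var 0)) 0) (BEx (Succ (Var 1)) (And (Mem (pair (Var 3) (Var 0)) 1)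
              (Eq (Var 2) (pair (Var 1) (Var 0)))))" and
        q = "Imp (Mem (pair (Var 2) (Var 0)) 0) (BEx (Succ (Var 1)) (And (Mem (pair (Var 3) (Var 0)) 1)
              (Eq (Var 2) (pair (Var 1) (Var 0)))))"])
    (use assms in \<open>auto simp: Delta00_intros recf_def less_succ le_pr split: nat.splits\<close>)

text \<open>
  Functions defined on pairs by a term, such as the projections, addition and multiplication. The value 0
  outside the pairs agrees with the projections being 0 there.
\<close>

lemma recf_decode:
  assumes "\<And>u v. F (pr u v) = val (v ## u ## e) t" "\<And>x. (\<And>u v. x \<noteq> pr u v) \<Longrightarrow> F x = \<zero>"
  shows "recf F"
proof (rule recf_delta0[where E = "\<lambda>_. SOME X. X \<in> sets" and e = e])
  define s where "s = subst_tm (case_nat (Var 0) (case_nat (Var 1) (\<lambda>i. Var (Suc (Suc (Suc (Suc i))))))) t"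
  have s: "val (v ## u ## y ## x ## e) s = val (v ## u ## e) t" for u v x y
    unfolding s_def val_subst by (rule arg_cong[where f = "\<lambda>e. val e t"]) (auto simp: fun_eq_iff split: nat.split)
  define N where "N = BAll (Succ (Var 1)) (BAll (Succ (Var 2)) (Neg (Eq (Var 3) (pair (Var 1) (Var 0)))))"
  define p where "p = Or (BEx (Succ (Var 1)) (BEx (Succ (Var 2)) (And (Eq (Var 3) (pair (Var 1) (Var 0)))
    (Eq (Var 2) s)))) (And N (Eq (Var 0) Zero))"
  show "Delta00 p" by (simp add: p_def N_def Delta00_intros)
  fix x y
  have N: "sat (y ## x ## e) E N \<longleftrightarrow> (\<forall>u v. x \<noteq> pr u v)" for E
    unfolding N_def by (simp add: less_succ) (use le_pr in blast)
  show "F x = y \<longleftrightarrow> sat (y ## x ## e) (\<lambda>_. SOME X. X \<in> sets) p"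
  proof (cases "\<exists>u v. x = pr u v")
    case True
    then obtain u v where "x = pr u v" by blast
    then show ?thesis using N by (auto simp: p_def s assms(1) less_succ le_pr)
  next
    case False
    then have "F x = \<zero>" using assms(2) by blast
    then show ?thesis using False N by (auto simp: p_def)
  qed
qed (use sets_nonempty in \<open>auto simp: some_in_eq\<close>)

lemma p1_p2_nonpair [simp]: "(\<And>u v. x \<noteq> pr u v) \<Longrightarrow> p1 x = \<zero>" "(\<And>u v. x \<noteq> pr u v) \<Longrightarrow> p2 x = \<zero>"
  by (auto simp: p1_def p2_def)

lemma recf_p1: "recf F \<Longrightarrow> recf (\<lambda>x. p1 (F x))"
  by (rule recf_comp[of p1]) (rule recf_decode[where t = "Var 1"], auto)

lemma recf_p2: "recf F \<Longrightarrow> recf (\<lambda>x. p2 (F x))"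
  by (rule recf_comp[of p2]) (rule recf_decode[where t = "Var 0"], auto)

lemma recf_comp2:
  assumes "recf (\<lambda>z. h (p1 z) (p2 z))" "recf F" "recf G"
  shows "recf (\<lambda>x. h (F x) (G x))"
  using recf_comp[OF assms(1) recf_pr[OF assms(2,3)]] by simp

lemma recf_plus: "recf F \<Longrightarrow> recf G \<Longrightarrow> recf (\<lambda>x. F x \<oplus> G x)"
  by (rule recf_comp2[where h = plus]) (rule recf_decode[where t = "Plus (Var 1) (Var 0)"], auto)

lemma recf_times: "recf F \<Longrightarrow> recf G \<Longrightarrow> recf (\<lambda>x. F x \<otimes> G x)"
  by (rule recf_comp2[where h = times]) (rule recf_decode[where t = "Times (Var 1) (Var 0)"], auto)

lemma rec_comp:
  assumes "rec P" "recf F"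
  shows "rec (\<lambda>x. P (F x))"
  unfolding rec_def
  using delta1_comp[of "And (Mem (pair (Var 1) (Var 0)) 0) (Mem (Var 0) 1)"
      "Imp (Mem (pair (Var 1) (Var 0)) 0) (Mem (Var 0) 1)" "graph F ## (\<lambda>_. {x. P x})"] assms
  by (auto simp: Delta00_intros recf_def rec_def image_subset_iff split: nat.splits)

lemma rec_comp2:
  assumes "rec (\<lambda>z. P (p1 z) (p2 z))" "recf F" "recf G"
  shows "rec (\<lambda>x. P (F x) (G x))"
  using rec_comp[OF assms(1) recf_pr[OF assms(2,3)]] by simp

lemma rec_imp: "rec P \<Longrightarrow> rec Q \<Longrightarrow> rec (\<lambda>x. P x \<longrightarrow> Q x)"
  unfolding rec_def
  using delta0_comp[of "Imp (Mem (Var 0) 0) (Mem (Var 0) 1)" "{x. P x} ## (\<lambda>_. {x. Q x})"]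
  by (auto simp: Delta00_intros image_subset_iff split: nat.splits)

lemma rec_not: "rec P \<Longrightarrow> rec (\<lambda>x. \<not> P x)"
  unfolding rec_def
  using delta0_comp[of "Neg (Mem (Var 0) 0)" "\<lambda>_. {x. P x}"]
  by (auto simp: Delta00_intros image_subset_iff split: nat.splits)

lemma rec_conj: "rec P \<Longrightarrow> rec Q \<Longrightarrow> rec (\<lambda>x. P x \<and> Q x)"
  using rec_not[OF rec_imp[OF _ rec_not]] by simp

lemma rec_disj: "rec P \<Longrightarrow> rec Q \<Longrightarrow> rec (\<lambda>x. P x \<or> Q x)"
  using rec_imp[OF rec_not] by (simp add: disj_imp)

lemma rec_decode:
  assumes p: "Delta00 p" and E: "range E \<subseteq> sets"
    and P: "\<And>u v. P (pr u v) \<longleftrightarrow> sat (v ## u ## e) E p" "\<And>x. (\<And>u v. x \<noteq> pr u v) \<Longrightarrow> \<not> P x"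
  shows "rec P"
proof -
  define \<sigma> where "\<sigma> = case_nat (Var 0) (case_nat (Var 1) (\<lambda>i. Var (Suc (Suc (Suc i)))))"
  define s where "s = subst \<sigma> (\<lambda>i. i) p"
  have "(\<lambda>i. val (v ## u ## x ## e) (\<sigma> i)) = v ## u ## e" for v u x
    by (auto simp: fun_eq_iff \<sigma>_def split: nat.split)
  then have s: "sat (v ## u ## x ## e) E s \<longleftrightarrow> sat (v ## u ## e) E p" for v u x
    by (simp add: s_def sat_subst)
  define q where "q = BEx (Succ (Var 0)) (BEx (Succ (Var 1)) (And (Eq (Var 2) (pair (Var 1) (Var 0))) s))"
  have "Delta00 q" unfolding q_def s_def by (intro Delta00_intros Delta00_subst p)
  then have "{x. sat (x ## e) E q} \<in> sets" using E by (rule delta0_comp)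
  moreover have "sat (x ## e) E q \<longleftrightarrow> P x" for x
    using P by (cases "\<exists>u v. x = pr u v") (auto simp: q_def s less_succ le_pr)
  ultimately show ?thesis by (simp add: rec_def)
qed

lemma rec_less: "recf F \<Longrightarrow> recf G \<Longrightarrow> rec (\<lambda>x. F x \<prec> G x)"
  by (rule rec_comp2[where P = less], rule rec_decode[where p = "Less (Var 1) (Var 0)" and
        E = "\<lambda>_. SOME X. X \<in> sets"])
    (use sets_nonempty in \<open>auto simp: Delta00_intros some_in_eq less_irrefl\<close>)

lemma rec_le: "recf F \<Longrightarrow> recf G \<Longrightarrow> rec (\<lambda>x. F x \<preceq> G x)"
  using rec_not[OF rec_less, of G F] by (simp add: arith.not_less)

lemma rec_eq: "recf F \<Longrightarrow> recf G \<Longrightarrow> rec (\<lambda>x. F x = G x)"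
  using rec_conj[OF rec_le rec_le, of F G G F] by (simp add: arith.order.eq_iff)

lemma rec_const: "rec (\<lambda>x. P)"
  using rec_eq[OF recf_id recf_id] rec_not[OF rec_eq[OF recf_id recf_id]] by (cases P) simp_all

lemma rec_ball:
  assumes "rec (\<lambda>z. P (p1 z) (p2 z))" "recf F"
  shows "rec (\<lambda>x. \<forall>y. y \<prec> F x \<longrightarrow> P x y)"
proof -
  have "rec (\<lambda>z. \<exists>y. y \<prec> p2 z \<and> \<not> P (p1 z) y)"
    by (rule rec_decode[where E = "\<lambda>_. {z. P (p1 z) (p2 z)}" and
          p = "BEx (Var 0) (Neg (Mem (pair (Var 2) (Var 0)) 0))"])
      (use assms(1) in \<open>auto simp: Delta00_intros rec_def basic\<close>)
  from rec_not[OF rec_comp2[OF this recf_id assms(2)]] show ?thesis by simp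
qed

lemma rec_bex:
  assumes "rec (\<lambda>z. P (p1 z) (p2 z))" "recf F"
  shows "rec (\<lambda>x. \<exists>y. y \<prec> F x \<and> P x y)"
  using rec_not[OF rec_ball[OF rec_not[OF assms(1)] assms(2)]] by simp

text \<open>
  Applied backwards, these rules reduce the recursiveness of an explicitly given predicate or function to
  that of its parameters.
\<close>

named_theorems recs
lemmas [recs] = recf_id recf_p1 recf_p2 recf_plus recf_times recf_pr
  rec_imp rec_not rec_conj rec_disj rec_less rec_le rec_eq rec_ball rec_bex recf_const rec_const

lemma rec_induct:
  assumes "rec P" "P \<zero>" "\<And>x. P x \<Longrightarrow> P (x \<oplus> \<one>)"
  shows "P x"
  using set_induct[of "{x. P x}" x] assms by (simp add: rec_def)

lemma rec_least:
  assumes "rec P" "P x"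
  shows "\<exists>y. P y \<and> (\<forall>z. z \<prec> y \<longrightarrow> \<not> P z)"
proof (rule ccontr)
  assume *: "\<not> ?thesis"
  have "\<forall>z. z \<prec> x \<oplus> \<one> \<longrightarrow> \<not> P z"
  proof (rule rec_induct[where x = "x \<oplus> \<one>"])
    show "rec (\<lambda>x. \<forall>z. z \<prec> x \<longrightarrow> \<not> P z)"
      by (intro recs rec_comp[OF assms(1)])
  next
    fix y assume "\<forall>z. z \<prec> y \<longrightarrow> \<not> P z"
    then show "\<forall>z. z \<prec> y \<oplus> \<one> \<longrightarrow> \<not> P z" using * by (metis basic(8))
  qed (simp add: basic)
  then show False using assms(2) basic(8) by blast
qed

text \<open>
  The least number operator.
\<close>

definition mu :: "('a \<Rightarrow> bool) \<Rightarrow> 'a" where "mu P = (THE x. P x \<and> (\<forall>y. y \<prec> x \<longrightarrow> \<not> P y))"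

lemma mu_eq:
  assumes "P x" "\<And>y. y \<prec> x \<Longrightarrow> \<not> P y"
  shows "mu P = x"
  unfolding mu_def using assms less_linear by (intro the_equality) blast+

lemma mu:
  assumes "rec P" "P x"
  shows "P (mu P)" "y \<prec> mu P \<Longrightarrow> \<not> P y"
proof -
  obtain z where z: "P z" "\<And>y. y \<prec> z \<Longrightarrow> \<not> P y" using rec_least[OF assms] by blast
  then have "mu P = z" by (rule mu_eq)
  then show "P (mu P)" "y \<prec> mu P \<Longrightarrow> \<not> P y" using z by auto
qed

lemma rec_section: "rec (\<lambda>z. P (p1 z) (p2 z)) \<Longrightarrow> rec (P x)"
  by (rule rec_comp2[where P = P], assumption) (intro recs)+

lemma recf_mu:
  assumes P: "rec (\<lambda>z. P (p1 z) (p2 z))" and ex: "\<And>x. \<exists>y. P x y"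
  shows "recf (\<lambda>x. mu (P x))"
proof (rule recf_delta0[where E = "\<lambda>_. {z. P (p1 z) (p2 z)}" and e = "\<lambda>_. \<zero>" and
    p = "And (Mem (pair (Var 1) (Var 0)) 0) (BAll (Var 0) (Neg (Mem (pair (Var 2) (Var 0)) 0)))"])
  fix x y
  have "mu (P x) = y \<longleftrightarrow> P x y \<and> (\<forall>v. v \<prec> y \<longrightarrow> \<not> P x v)"
    using mu[OF rec_section[OF P, of x]] ex[of x] mu_eq[of "P x" y] by blast
  then show "mu (P x) = y \<longleftrightarrow> sat (y ## x ## (\<lambda>_. \<zero>)) (\<lambda>_. {z. P (p1 z) (p2 z)})
      (And (Mem (pair (Var 1) (Var 0)) 0) (BAll (Var 0) (Neg (Mem (pair (Var 2) (Var 0)) 0))))"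
    by auto
qed (use P in \<open>auto simp: rec_def Delta00_intros\<close>)

lemma rec_sigma1_induct:
  assumes P: "rec (\<lambda>z. P (p1 z) (p2 z))" and "\<exists>y. P \<zero> y"
    and "\<And>x y. P x y \<Longrightarrow> \<exists>y. P (x \<oplus> \<one>) y"
  shows "\<exists>y. P x y"
proof -
  have sat: "sat (y ## x ## (\<lambda>_. \<zero>)) (\<lambda>_. {z. P (p1 z) (p2 z)}) (Mem (pair (Var 1) (Var 0)) 0) \<longleftrightarrow> P x y"
    for x y by simp
  have "\<exists>y. sat (y ## x ## (\<lambda>_. \<zero>)) (\<lambda>_. {z. P (p1 z) (p2 z)}) (Mem (pair (Var 1) (Var 0)) 0)"
    by (rule sigma1_induct) (use assms in \<open>unfold sat rec_def, auto simp: Delta00_intros\<close>)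
  then show ?thesis unfolding sat .
qed

section \<open>Coding finite sets and primitive recursion\<close>

text \<open>
  The moduli \<open>1 + (x + 1) b\<close> of Goedel's coding. A number \<open>a\<close> together with \<open>b\<close> codes the set of those
  \<open>x\<close> for which the modulus divides \<open>a\<close>.
\<close>

definition modulus :: "'a \<Rightarrow> 'a \<Rightarrow> 'a" where "modulus b x = \<one> \<oplus> (x \<oplus> \<one>) \<otimes> b"

definition divs :: "'a \<Rightarrow> 'a \<Rightarrow> 'a \<Rightarrow> bool" where "divs b x a \<longleftrightarrow> (\<exists>q. a = modulus b x \<otimes> q)"

lemma divs_bounded: "divs b x a \<longleftrightarrow> (\<exists>q. q \<prec> a \<oplus> \<one> \<and> a = modulus b x \<otimes> q)"
proof -
  have "q \<preceq> modulus b x \<otimes> q" for q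
  proof -
    have "modulus b x \<otimes> q = q \<oplus> (x \<oplus> \<one>) \<otimes> b \<otimes> q" by (simp add: modulus_def algebra_simps)
    then show ?thesis by (simp add: le_iff)
  qed
  then show ?thesis by (auto simp: divs_def less_succ)
qed

lemma divs_mult: "divs b x a \<Longrightarrow> divs b x (a \<otimes> c)"
  by (auto simp: divs_def mult_assoc)

lemma divs_summand:
  assumes "modulus b x \<otimes> r = modulus b x \<otimes> t \<oplus> a"
  shows "divs b x a"
proof -
  have "a = modulus b x \<otimes> r \<ominus> modulus b x \<otimes> t" using assms by simp
  also have "\<dots> = modulus b x \<otimes> (r \<ominus> t)" by (simp add: arith.right_diff_distrib')
  finally show ?thesis by (auto simp: divs_def)
qed

text \<open>
  Two moduli at distance \<open>u\<close>, where \<open>u\<close> divides \<open>b\<close>, are coprime. An inverse can be written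
  down: modulo \<open>1 + (x + 1) b\<close> one has \<open>(x + 1) b = -1\<close>, hence
  \<open>(x + 1) (1 + (j + 1) b) = x - j\<close>, and multiplication by \<open>w (x + 1)\<close> with \<open>b = u w\<close> turns the right side
  into \<open>1\<close> or \<open>-1\<close>. The two cases differ in this sign, as there are no negative numbers to express it.
\<close>

lemma divs_cancel:
  assumes d: "divs b x (a \<otimes> modulus b j)" and b: "b = u \<otimes> w" and u: "x = j \<oplus> u \<or> j = x \<oplus> u"
  shows "divs b x a"
proof -
  obtain r where r: "a \<otimes> modulus b j = modulus b x \<otimes> r" using d by (auto simp: divs_def)
  let ?W = "w \<otimes> (x \<oplus> \<one>) \<otimes> (x \<oplus> \<one>)" and ?V = "w \<otimes> (x \<oplus> \<one>) \<otimes> (j \<oplus> \<one>)"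
  show ?thesis using u
  proof
    assume x: "x = j \<oplus> u"
    have "modulus b j \<otimes> ?W \<oplus> \<one> = modulus b x \<otimes> (\<one> \<oplus> ?V)"
      unfolding modulus_def b x by (simp add: algebra_simps)
    then have "a \<otimes> modulus b j \<otimes> ?W \<oplus> a = modulus b x \<otimes> (a \<otimes> (\<one> \<oplus> ?V))"
      by (metis distrib_left mult_1_right mult_assoc mult_comm)
    then have "modulus b x \<otimes> (a \<otimes> (\<one> \<oplus> ?V)) = modulus b x \<otimes> (r \<otimes> ?W) \<oplus> a"
      unfolding r by (simp add: mult_assoc)
    then show ?thesis by (rule divs_summand)
  next
    assume j: "j = x \<oplus> u"
    have "modulus b j \<otimes> ?W \<oplus> modulus b x = modulus b x \<otimes> ?V \<oplus> \<one>"
      unfolding modulus_def b j by (simp add: algebra_simps)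
    then have "a \<otimes> (modulus b j \<otimes> ?W \<oplus> modulus b x) = a \<otimes> (modulus b x \<otimes> ?V \<oplus> \<one>)" by simp
    then have "a \<otimes> modulus b j \<otimes> ?W \<oplus> a \<otimes> modulus b x = a \<otimes> (modulus b x \<otimes> ?V) \<oplus> a"
      by (simp add: distrib_left mult_1_right mult_assoc)
    then have "modulus b x \<otimes> (r \<otimes> ?W \<oplus> a) = modulus b x \<otimes> (a \<otimes> ?V) \<oplus> a"
      unfolding r by (metis distrib_left mult_assoc mult_comm)
    then show ?thesis by (rule divs_summand)
  qed
qed

lemma recf_modulus [recs]: "recf F \<Longrightarrow> recf G \<Longrightarrow> recf (\<lambda>x. modulus (F x) (G x))"
  unfolding modulus_def by (intro recs)

lemma rec_divs [recs]: "recf F \<Longrightarrow> recf G \<Longrightarrow> recf H \<Longrightarrow> rec (\<lambda>x. divs (F x) (G x) (H x))"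
  unfolding divs_bounded
  by (assumption | rule recs | rule recf_comp[of F] recf_comp[of G] recf_comp[of H])+

text \<open>
  The role of \<open>b\<close> would usually be played by a factorial, but that is itself defined by primitive recursion.
\<close>

lemma common_multiple: "\<exists>b. \<zero> \<prec> b \<and> n \<preceq> b \<and> (\<forall>u. \<zero> \<prec> u \<longrightarrow> u \<preceq> n \<longrightarrow> (\<exists>w. b = u \<otimes> w))"
proof -
  have "\<exists>b. \<zero> \<prec> b \<and> (\<forall>u. u \<prec> n \<oplus> \<one> \<longrightarrow> \<zero> \<prec> u \<longrightarrow> (\<exists>w. w \<prec> b \<oplus> \<one> \<and> b = u \<otimes> w))"
  proof (rule rec_sigma1_induct[where x = n])
    show "rec (\<lambda>z. \<zero> \<prec> p2 z \<and> (\<forall>u. u \<prec> p1 z \<oplus> \<one> \<longrightarrow> \<zero> \<prec> u \<longrightarrow>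
        (\<exists>w. w \<prec> p2 z \<oplus> \<one> \<and> p2 z = u \<otimes> w)))"
      by (intro recs)
  next
    show "\<exists>b. \<zero> \<prec> b \<and> (\<forall>u. u \<prec> \<zero> \<oplus> \<one> \<longrightarrow> \<zero> \<prec> u \<longrightarrow> (\<exists>w. w \<prec> b \<oplus> \<one> \<and> b = u \<otimes> w))"
    proof (rule exI[of _ \<one>], intro conjI allI impI)
      show "\<exists>w. w \<prec> \<one> \<oplus> \<one> \<and> \<one> = u \<otimes> w" if "u \<prec> \<zero> \<oplus> \<one>" "\<zero> \<prec> u" for u
        using that basic(7)[of u] basic(8)[of u \<zero>] less_irrefl by auto
    qed simp
  next
    fix n b assume b: "\<zero> \<prec> b \<and> (\<forall>u. u \<prec> n \<oplus> \<one> \<longrightarrow> \<zero> \<prec> u \<longrightarrow> (\<exists>w. w \<prec> b \<oplus> \<one> \<and> b = u \<otimes> w))"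
    let ?b = "b \<otimes> (n \<oplus> \<one>)"
    have pos: "\<zero> \<prec> ?b" using b by (simp add: zero_less_iff basic(1))
    have "\<exists>w. w \<prec> ?b \<oplus> \<one> \<and> ?b = u \<otimes> w" if u: "u \<prec> n \<oplus> \<one> \<oplus> \<one>" "\<zero> \<prec> u" for u
    proof -
      have "\<exists>w. ?b = u \<otimes> w"
      proof (cases "u = n \<oplus> \<one>")
        case True
        then show ?thesis using mult_comm by blast
      next
        case False
        then have "u \<prec> n \<oplus> \<one>" using u basic(8) by blast
        then show ?thesis using b u mult_assoc by metis
      qed
      then obtain w where w: "?b = u \<otimes> w" by blast
      obtain v where "u = v \<oplus> \<one>" using u zero_or_succ[of u] less_irrefl by blast
      then have "?b = w \<oplus> v \<otimes> w" using w by (simp add: algebra_simps)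
      then have "w \<preceq> ?b" using le_iff by blast
      then show ?thesis using w less_succ by blast
    qed
    then show "\<exists>b. \<zero> \<prec> b \<and> (\<forall>u. u \<prec> n \<oplus> \<one> \<oplus> \<one> \<longrightarrow> \<zero> \<prec> u \<longrightarrow> (\<exists>w. w \<prec> b \<oplus> \<one> \<and> b = u \<otimes> w))"
      using pos by blast
  qed
  then obtain b where b: "\<zero> \<prec> b" "\<And>u. u \<prec> n \<oplus> \<one> \<Longrightarrow> \<zero> \<prec> u \<Longrightarrow> \<exists>w. b = u \<otimes> w" by blast
  have "n \<preceq> b"
  proof (cases "n = \<zero>")
    case False
    then obtain w where w: "b = n \<otimes> w" using b(2)[of n] by (auto simp: less_succ zero_less_iff)
    then have "w \<noteq> \<zero>" using b(1) by (auto simp: less_irrefl)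
    then obtain v where "w = v \<oplus> \<one>" using zero_or_succ by blast
    then have "b = n \<oplus> n \<otimes> v" using w by (simp add: algebra_simps)
    then show ?thesis using le_iff by blast
  qed simp
  then show ?thesis using b less_succ by blast
qed

definition mem :: "'a \<Rightarrow> 'a \<Rightarrow> bool" where "mem x s \<longleftrightarrow> divs (p2 s) x (p1 s)"

lemma rec_mem [recs]: "recf F \<Longrightarrow> recf G \<Longrightarrow> rec (\<lambda>x. mem (F x) (G x))"
  unfolding mem_def by (intro recs)

text \<open>
  With \<open>b\<close> divisible by all positive numbers up to \<open>n\<close>, the code \<open>a\<close> is the product of the moduli of those \<open>x < n\<close>
  that satisfy \<open>P\<close>. Coprimality ensures that no other modulus divides it. The existence of the product is a
  \<open>\<Sigma>\<^sub>1\<close> induction on the number \<open>j\<close> of points already treated.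
\<close>

lemma finite_set_code:
  assumes P: "rec P"
  shows "\<exists>s. n \<preceq> s \<and> (\<forall>x. x \<prec> n \<longrightarrow> (mem x s \<longleftrightarrow> P x))"
proof -
  obtain b where b: "\<zero> \<prec> b" "n \<preceq> b" "\<And>u. \<zero> \<prec> u \<Longrightarrow> u \<preceq> n \<Longrightarrow> \<exists>w. b = u \<otimes> w"
    using common_multiple by blast
  have cancel: "divs b x (a \<otimes> modulus b j) \<longleftrightarrow> divs b x a" if lt: "x \<prec> n" "j \<prec> n" "x \<noteq> j" for x j a
  proof -
    have "\<exists>u. (x = j \<oplus> u \<or> j = x \<oplus> u) \<and> u \<noteq> \<zero> \<and> u \<preceq> n"
    proof (cases "j \<preceq> x")
      case True
      then obtain u where "x = j \<oplus> u" using le_iff by blast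
      moreover from this have "u \<preceq> x" by simp
      ultimately show ?thesis using lt by (metis arith.order.trans basic(3) le_def)
    next
      case False
      then have "x \<preceq> j" using arith.linear by blast
      then obtain u where "j = x \<oplus> u" using le_iff by blast
      moreover from this have "u \<preceq> j" by simp
      ultimately show ?thesis using lt by (metis arith.order.trans basic(3) le_def)
    qed
    then show ?thesis using b(3) zero_less_iff divs_cancel divs_mult by metis
  qed
  have "\<exists>a. \<forall>x. x \<prec> n \<longrightarrow> (divs b x a \<longleftrightarrow> P x \<and> x \<prec> j)" for j
  proof (rule rec_sigma1_induct[where x = j])
    have "rec (\<lambda>z. \<forall>x. x \<prec> n \<longrightarrow> (divs b x (p2 z) \<longrightarrow> P x \<and> x \<prec> p1 z) \<and> (P x \<and> x \<prec> p1 z \<longrightarrow> divs b x (p2 z)))"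
      by (rule recs rec_comp[OF P])+
    then show "rec (\<lambda>z. \<forall>x. x \<prec> n \<longrightarrow> (divs b x (p2 z) \<longleftrightarrow> P x \<and> x \<prec> p1 z))"
      by (simp only: iff_conv_conj_imp)
  next
    have "\<not> divs b x \<one>" for x
    proof
      assume "divs b x \<one>"
      then obtain q where q: "\<one> = modulus b x \<otimes> q" by (auto simp: divs_def)
      then have "q \<noteq> \<zero>" by auto
      then obtain r where r: "q = r \<oplus> \<one>" using zero_or_succ by blast
      have "\<one> = modulus b x \<otimes> r \<oplus> (x \<oplus> \<one>) \<otimes> b \<oplus> \<one>"
        using q unfolding r by (simp add: modulus_def algebra_simps)
      then have "modulus b x \<otimes> r \<oplus> (x \<oplus> \<one>) \<otimes> b = \<zero>" using basic(2)[of \<zero>] add_0_left by metis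
      then have "(x \<oplus> \<one>) \<otimes> b = \<zero>" by (metis basic(1,4) zero_or_succ)
      then show False using b(1) basic(1) by (auto simp: less_irrefl)
    qed
    then show "\<exists>a. \<forall>x. x \<prec> n \<longrightarrow> (divs b x a \<longleftrightarrow> P x \<and> x \<prec> \<zero>)" using basic(7) by blast
  next
    fix j a assume a: "\<forall>x. x \<prec> n \<longrightarrow> (divs b x a \<longleftrightarrow> P x \<and> x \<prec> j)"
    show "\<exists>a. \<forall>x. x \<prec> n \<longrightarrow> (divs b x a \<longleftrightarrow> P x \<and> x \<prec> j \<oplus> \<one>)"
    proof (cases "P j \<and> j \<prec> n")
      case True
      have "divs b j (a \<otimes> modulus b j)" using mult_comm by (auto simp: divs_def)
      then show ?thesis using True a cancel basic(8) by (intro exI[of _ "a \<otimes> modulus b j"]) metis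
    next
      case False
      then show ?thesis using a basic(8) by (intro exI[of _ a]) metis
    qed
  qed
  then obtain a where "\<forall>x. x \<prec> n \<longrightarrow> (divs b x a \<longleftrightarrow> P x \<and> x \<prec> n)" by blast
  moreover have "n \<preceq> pr a b" using b(2) le_pr(2) arith.order.trans by blast
  ultimately show ?thesis by (intro exI[of _ "pr a b"]) (simp add: mem_def)
qed

text \<open>
  A sequence is coded by the finite set of its pairs of position and value. The alternative \<open>v = s\<close> only makes
  the search succeed for every \<open>s\<close>; codes of sequences are chosen larger than all entries.
\<close>

definition entry :: "'a \<Rightarrow> 'a \<Rightarrow> 'a" where "entry s i = mu (\<lambda>v. mem (pr i v) s \<or> v = s)"

lemma recf_entry [recs]: "recf F \<Longrightarrow> recf G \<Longrightarrow> recf (\<lambda>x. entry (F x) (G x))"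
proof (rule recf_comp2[where h = entry])
  show "recf (\<lambda>z. entry (p1 z) (p2 z))"
    unfolding entry_def by (rule recf_mu) (intro recs, blast)
qed

lemma entry_le: "entry s i \<preceq> s"
proof -
  have "rec (\<lambda>v. mem (pr i v) s \<or> v = s)" by (intro recs)
  then have "\<not> s \<prec> mu (\<lambda>v. mem (pr i v) s \<or> v = s)" using mu by blast
  then show ?thesis by (simp add: entry_def arith.not_less)
qed

lemma sequence_code:
  assumes h: "recf h" and bound: "\<And>i. i \<prec> n \<Longrightarrow> h i \<preceq> m"
  shows "\<exists>s. \<forall>i. i \<prec> n \<longrightarrow> entry s i = h i"
proof -
  have "rec (\<lambda>z. h (p1 z) = p2 z)" by (rule recs recf_comp[OF h])+
  then obtain s where s: "pr n m \<oplus> \<one> \<preceq> s"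
    "\<And>x. x \<prec> pr n m \<oplus> \<one> \<Longrightarrow> mem x s \<longleftrightarrow> h (p1 x) = p2 x"
    using finite_set_code by blast
  have "entry s i = h i" if i: "i \<prec> n" for i
    unfolding entry_def
  proof (rule mu_eq)
    have le: "pr i v \<prec> pr n m \<oplus> \<one>" if "v \<preceq> h i" for v
      using pr_mono[of i n v m] i bound[OF i] that arith.order.trans by (auto simp: less_succ le_def[of i])
    then show "mem (pr i (h i)) s \<or> h i = s" by (simp add: s(2))
    fix v assume v: "v \<prec> h i"
    then have "v \<preceq> h i" by (simp add: le_def)
    then have "\<not> mem (pr i v) s" using s(2)[OF le] v less_irrefl by auto
    moreover have "v \<noteq> s"
    proof
      assume "v = s"
      then have "s \<prec> pr n m \<oplus> \<one>"
        using le[OF \<open>v \<preceq> h i\<close>] le_pr(2)[of v i] arith.order.strict_trans1 by blast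
      then show False using s(1) by (simp add: arith.not_less[symmetric])
    qed
    ultimately show "\<not> (mem (pr i v) s \<or> v = s)" by blast
  qed
  then show ?thesis by blast
qed

lemma recf_if:
  assumes "rec P" "recf F" "recf G"
  shows "recf (\<lambda>x. if P x then F x else G x)"
proof -
  have "recf (\<lambda>x. mu (\<lambda>y. (P x \<longrightarrow> y = F x) \<and> (\<not> P x \<longrightarrow> y = G x)))"
  proof (rule recf_mu)
    show "rec (\<lambda>z. (P (p1 z) \<longrightarrow> p2 z = F (p1 z)) \<and> (\<not> P (p1 z) \<longrightarrow> p2 z = G (p1 z)))"
      by (rule recs rec_comp[OF assms(1)] recf_comp[OF assms(2)] recf_comp[OF assms(3)])+
  qed auto
  moreover have "mu (\<lambda>y. (P x \<longrightarrow> y = F x) \<and> (\<not> P x \<longrightarrow> y = G x)) = (if P x then F x else G x)" for x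
    by (rule mu_eq) (auto simp: less_irrefl split: if_splits)
  ultimately show ?thesis by simp
qed

text \<open>
  The computation up to \<open>n\<close> is coded by a sequence \<open>s\<close> with \<open>R p n s\<close>. Such a code exists by \<open>\<Sigma>\<^sub>1\<close> induction on
  \<open>n\<close>, and \<open>h p n\<close> is read off from the least one. Different codes agree on the computed values, which gives
  the recursion equation.
\<close>

lemma primitive_recursion:
  assumes c: "recf c" and g: "recf (\<lambda>z. g (p1 z) (p1 (p2 z)) (p2 (p2 z)))"
  obtains h where "recf (\<lambda>z. h (p1 z) (p2 z))" "\<And>p. h p \<zero> = c p"
    "\<And>p n. h p (n \<oplus> \<one>) = g p n (h p n)"
proof -
  have g': "recf (\<lambda>x. g (F x) (G x) (H x))" if "recf F" "recf G" "recf H" for F G H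
    using recf_comp[OF g recf_pr[OF that(1) recf_pr[OF that(2,3)]]] by simp
  define R where "R p n s \<longleftrightarrow> entry s \<zero> = c p \<and> (\<forall>i. i \<prec> n \<longrightarrow> entry s (i \<oplus> \<one>) = g p i (entry s i))" for p n s
  have R: "rec (\<lambda>x. R (F x) (G x) (H x))" if "recf F" "recf G" "recf H" for F G H
    unfolding R_def
    using that
    by - (assumption | rule recs g' recf_comp[OF c] recf_comp[OF that(1)] recf_comp[OF that(2)] recf_comp[OF that(3)])+
  have ex: "\<exists>s. R p n s" for p n
  proof (rule rec_sigma1_induct[where x = n])
    show "rec (\<lambda>z. R p (p1 z) (p2 z))" by (intro R recs)
    have "\<exists>s. \<forall>i. i \<prec> \<one> \<longrightarrow> entry s i = c p"
      by (rule sequence_code) (auto intro: recf_const)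
    then obtain s where "entry s \<zero> = c p" using arith.zero_less_one by blast
    then have "R p \<zero> s" by (simp add: R_def basic)
    then show "\<exists>s. R p \<zero> s" by blast
  next
    fix n s assume s: "R p n s"
    define v where "v = g p n (entry s n)"
    \<comment> \<open>The next code cannot be obtained by modifying \<open>s\<close>, as a new \<open>b\<close> may be needed; the extended sequence is coded afresh.\<close>
    define h where "h i = (if i \<prec> n \<oplus> \<one> then entry s i else v)" for i
    have "recf h" unfolding h_def by (intro recf_if recs)
    moreover have "h i \<preceq> s \<oplus> v" for i
      using entry_le[of s i] arith.order.trans[of "entry s i" s "s \<oplus> v"] by (simp add: h_def)
    ultimately obtain t where t: "\<And>i. i \<prec> n \<oplus> \<one> \<oplus> \<one> \<Longrightarrow> entry t i = h i"
      using sequence_code by blast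
    have "R p (n \<oplus> \<one>) t"
      unfolding R_def
    proof (intro conjI allI impI)
      show "entry t \<zero> = c p" using s t[of \<zero>] by (simp add: R_def h_def less_succ)
    next
      fix i assume i: "i \<prec> n \<oplus> \<one>"
      then have "entry t i = entry s i" using t[of i] basic(8) by (simp add: h_def)
      moreover have "entry t (i \<oplus> \<one>) = h (i \<oplus> \<one>)"
        using t[of "i \<oplus> \<one>"] i by simp
      moreover have "h (i \<oplus> \<one>) = g p i (entry s i)"
        using s i by (auto simp: h_def v_def R_def basic(8)[of i n] less_irrefl)
      ultimately show "entry t (i \<oplus> \<one>) = g p i (entry t i)" by simp
    qed
    then show "\<exists>t. R p (n \<oplus> \<one>) t" by blast
  qed
  have unique: "i \<preceq> n \<longrightarrow> i \<preceq> m \<longrightarrow> entry s i = entry t i" if "R p n s" "R p m t" for p n m s t i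
  proof (rule rec_induct[where x = i])
    show "rec (\<lambda>i. i \<preceq> n \<longrightarrow> i \<preceq> m \<longrightarrow> entry s i = entry t i)" by (intro recs)
    show "\<zero> \<preceq> n \<longrightarrow> \<zero> \<preceq> m \<longrightarrow> entry s \<zero> = entry t \<zero>" using that by (simp add: R_def)
    show "i \<oplus> \<one> \<preceq> n \<longrightarrow> i \<oplus> \<one> \<preceq> m \<longrightarrow> entry s (i \<oplus> \<one>) = entry t (i \<oplus> \<one>)"
      if IH: "i \<preceq> n \<longrightarrow> i \<preceq> m \<longrightarrow> entry s i = entry t i" for i
    proof (intro impI)
      assume "i \<oplus> \<one> \<preceq> n" "i \<oplus> \<one> \<preceq> m"
      then have "i \<prec> n" "i \<prec> m" by (simp_all add: succ_le)
      then show "entry s (i \<oplus> \<one>) = entry t (i \<oplus> \<one>)"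
        using IH \<open>R p n s\<close> \<open>R p m t\<close> by (simp add: R_def le_def)
    qed
  qed
  define h where "h p n = entry (mu (R p n)) n" for p n
  have min: "R p n (mu (R p n))" for p n
  proof -
    have "rec (R p n)" using R[OF recf_const recf_const recf_id] by simp
    then show ?thesis using ex mu by blast
  qed
  show ?thesis
  proof (rule that)
    show "recf (\<lambda>z. h (p1 z) (p2 z))"
      unfolding h_def by (intro recs recf_mu R) (rule ex)
    show "h p \<zero> = c p" for p using min[of p \<zero>] by (simp add: h_def R_def)
    fix p n
    let ?s = "mu (R p n)" and ?t = "mu (R p (n \<oplus> \<one>))"
    have "entry ?s n = entry ?t n" using unique[OF min[of p n] min[of p "n \<oplus> \<one>"], of n] by (simp add: le_def basic(8))
    moreover have "entry ?t (n \<oplus> \<one>) = g p n (entry ?t n)" using min[of p "n \<oplus> \<one>"] by (simp add: R_def basic(8))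
    ultimately show "h p (n \<oplus> \<one>) = g p n (h p n)" by (simp add: h_def)
  qed
qed

definition prim_rec :: "('a \<Rightarrow> 'a) \<Rightarrow> ('a \<Rightarrow> 'a \<Rightarrow> 'a \<Rightarrow> 'a) \<Rightarrow> 'a \<Rightarrow> 'a \<Rightarrow> 'a" where
  "prim_rec c g = (SOME h. recf (\<lambda>z. h (p1 z) (p2 z)) \<and> (\<forall>p. h p \<zero> = c p) \<and>
     (\<forall>p n. h p (n \<oplus> \<one>) = g p n (h p n)))"

lemma prim_rec:
  assumes "recf c" "recf (\<lambda>z. g (p1 z) (p1 (p2 z)) (p2 (p2 z)))"
  shows "recf (\<lambda>z. prim_rec c g (p1 z) (p2 z))" "prim_rec c g p \<zero> = c p"
    "prim_rec c g p (n \<oplus> \<one>) = g p n (prim_rec c g p n)"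
proof -
  have "\<exists>h. recf (\<lambda>z. h (p1 z) (p2 z)) \<and> (\<forall>p. h p \<zero> = c p) \<and> (\<forall>p n. h p (n \<oplus> \<one>) = g p n (h p n))"
    using primitive_recursion[OF assms] by metis
  from someI_ex[OF this] show "recf (\<lambda>z. prim_rec c g (p1 z) (p2 z))" "prim_rec c g p \<zero> = c p"
    "prim_rec c g p (n \<oplus> \<one>) = g p n (prim_rec c g p n)" unfolding prim_rec_def by blast+
qed

section \<open>Sums and bounded functions\<close>

text \<open>
  If every summand is dominated by its counterpart, a deficit in one of them cannot be made up by the others.
\<close>

lemma sums_mono:
  assumes rec: "recf d" "recf d'" "recf S" "recf S'" and zero: "S \<zero> = \<zero>" "S' \<zero> = \<zero>"
    and succ: "\<And>n. S (n \<oplus> \<one>) = S n \<oplus> d n" "\<And>n. S' (n \<oplus> \<one>) = S' n \<oplus> d' n"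
    and le: "\<And>c. d c \<preceq> d' c"
  shows "S n \<preceq> S' n" "S n = S' n \<Longrightarrow> c \<prec> n \<Longrightarrow> d c = d' c"
proof -
  have mono: "S n \<preceq> S' n" for n
  proof (rule rec_induct[where x = n])
    show "rec (\<lambda>n. S n \<preceq> S' n)" by (rule recs rec)+
  qed (simp_all add: zero succ arith.add_mono le)
  then show "S n \<preceq> S' n" .
  have "S n = S' n \<longrightarrow> (\<forall>c. c \<prec> n \<longrightarrow> d c = d' c)"
  proof (rule rec_induct[where x = n])
    show "rec (\<lambda>n. S n = S' n \<longrightarrow> (\<forall>c. c \<prec> n \<longrightarrow> d c = d' c))"
      by (rule recs recf_comp[OF rec(1)] recf_comp[OF rec(2)] rec(3,4))+
  next
    fix n assume IH: "S n = S' n \<longrightarrow> (\<forall>c. c \<prec> n \<longrightarrow> d c = d' c)"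
    have "S n = S' n \<and> d n = d' n" if eq: "S (n \<oplus> \<one>) = S' (n \<oplus> \<one>)"
    proof -
      have "\<not> S n \<oplus> d n \<prec> S' n \<oplus> d' n" using eq succ less_irrefl by simp
      then have "\<not> S n \<prec> S' n" "\<not> d n \<prec> d' n"
        using arith.add_less_le_mono[of "S n" "S' n" "d n" "d' n"]
          arith.add_le_less_mono[of "S n" "S' n" "d n" "d' n"] mono le by blast+
      then show ?thesis using mono[of n] le[of n] unfolding le_def by blast
    qed
    then show "S (n \<oplus> \<one>) = S' (n \<oplus> \<one>) \<longrightarrow> (\<forall>c. c \<prec> n \<oplus> \<one> \<longrightarrow> d c = d' c)"
      using IH basic(8) by metis
  qed (simp add: basic)
  then show "S n = S' n \<Longrightarrow> c \<prec> n \<Longrightarrow> d c = d' c" by blast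
qed

text \<open>
  If every value were exceeded by another one, \<open>\<Sigma>\<^sub>1\<close> induction would yield arbitrarily large values.
\<close>

lemma bounded_max:
  assumes v: "recf v" and bound: "\<And>m. v m \<preceq> w"
  shows "\<exists>m. \<forall>m'. v m' \<preceq> v m"
proof (rule ccontr)
  assume "\<not> ?thesis"
  then have *: "\<exists>m'. v m \<prec> v m'" for m using arith.not_less by blast
  have "\<exists>m. j \<preceq> v m" for j
  proof (rule rec_sigma1_induct[where x = j])
    show "rec (\<lambda>z. p1 z \<preceq> v (p2 z))" by (rule recs recf_comp[OF v])+
    show "\<exists>m. \<zero> \<preceq> v m" by simp
    fix j m assume "j \<preceq> v m"
    then show "\<exists>m. j \<oplus> \<one> \<preceq> v m" using *[of m] arith.order.strict_trans1 succ_le by blast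
  qed
  then obtain m where "w \<oplus> \<one> \<preceq> v m" by blast
  then show False using bound[of m] arith.not_less by (simp add: succ_le)
qed

end

section \<open>Eventually repeating tails\<close>

locale coloring = rca0_model +
  fixes f :: "'a \<Rightarrow> 'a" and k :: 'a
  assumes recf_f: "recf f" and f_less: "f x \<prec> k"
begin

lemma recf_f' [recs]: "recf F \<Longrightarrow> recf (\<lambda>x. f (F x))"
  by (rule recf_comp[OF recf_f])

text \<open>
  In the following definitions \<open>t\<close> and \<open>m\<close> delimit the interval \<open>[t, m)\<close>.
\<close>

definition occurs :: "'a \<Rightarrow> 'a \<Rightarrow> 'a \<Rightarrow> bool" where
  "occurs t m c \<longleftrightarrow> (\<exists>x. x \<prec> m \<and> t \<preceq> x \<and> f x = c)"

definition repeats :: "'a \<Rightarrow> 'a \<Rightarrow> 'a \<Rightarrow> bool" where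
  "repeats t m c \<longleftrightarrow> (\<exists>x. x \<prec> m \<and> (\<exists>y. y \<prec> x \<and> t \<preceq> y \<and> f y = c \<and> f x = c))"

definition single :: "'a \<Rightarrow> 'a \<Rightarrow> 'a \<Rightarrow> bool" where
  "single t m x \<longleftrightarrow> t \<preceq> x \<and> x \<prec> m \<and> \<not> repeats t m (f x)"

definition capped_count :: "'a \<Rightarrow> 'a \<Rightarrow> 'a \<Rightarrow> 'a" where
  "capped_count t m c = (if occurs t m c then \<one> else \<zero>) \<oplus> (if repeats t m c then \<one> else \<zero>)"

lemma rec_occurs [recs]:
  "recf F \<Longrightarrow> recf G \<Longrightarrow> recf H \<Longrightarrow> rec (\<lambda>x. occurs (F x) (G x) (H x))"
  unfolding occurs_def by (assumption | rule recs | rule recf_comp[of F] recf_comp[of G] recf_comp[of H])+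

lemma rec_repeats [recs]:
  "recf F \<Longrightarrow> recf G \<Longrightarrow> recf H \<Longrightarrow> rec (\<lambda>x. repeats (F x) (G x) (H x))"
  unfolding repeats_def by (assumption | rule recs | rule recf_comp[of F] recf_comp[of G] recf_comp[of H])+

lemma rec_single [recs]:
  "recf F \<Longrightarrow> recf G \<Longrightarrow> recf H \<Longrightarrow> rec (\<lambda>x. single (F x) (G x) (H x))"
  unfolding single_def by (assumption | rule recs)+

lemma recf_capped_count [recs]:
  "recf F \<Longrightarrow> recf G \<Longrightarrow> recf H \<Longrightarrow> recf (\<lambda>x. capped_count (F x) (G x) (H x))"
  unfolding capped_count_def by (assumption | rule recs recf_if)+

lemma repeats_occurs: "repeats t m c \<Longrightarrow> occurs t m c"
  unfolding repeats_def occurs_def using less_trans by blast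

lemma repeatsI:
  assumes "x \<prec> m" "y \<prec> m" "t \<preceq> x" "t \<preceq> y" "f x = c" "f y = c" "x \<noteq> y"
  shows "repeats t m c"
  using assms less_linear[of x y] unfolding repeats_def by blast

lemma occurs_mono: "occurs t m c \<Longrightarrow> t' \<preceq> t \<Longrightarrow> m \<preceq> m' \<Longrightarrow> occurs t' m' c"
  unfolding occurs_def using arith.order.trans arith.order.strict_trans2 by blast

lemma repeats_mono: "repeats t m c \<Longrightarrow> t' \<preceq> t \<Longrightarrow> m \<preceq> m' \<Longrightarrow> repeats t' m' c"
  unfolding repeats_def using arith.order.trans arith.order.strict_trans2 by blast

lemma capped_count_mono: "t' \<preceq> t \<Longrightarrow> m \<preceq> m' \<Longrightarrow> capped_count t m c \<preceq> capped_count t' m' c"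
  unfolding capped_count_def using occurs_mono[of t m c t' m'] repeats_mono[of t m c t' m']
  by (intro arith.add_mono) auto

lemma capped_count_eq:
  assumes "capped_count t m c = capped_count t m' c" "m \<preceq> m'"
  shows "occurs t m c \<longleftrightarrow> occurs t m' c" "repeats t m c \<longleftrightarrow> repeats t m' c"
proof -
  have "(occurs t m c \<longleftrightarrow> occurs t m' c) \<and> (repeats t m c \<longleftrightarrow> repeats t m' c)"
    using assms(1) occurs_mono[of t m c t m'] repeats_mono[of t m c t m'] assms(2)
      repeats_occurs[of t m c] repeats_occurs[of t m' c] basic(1)[of \<zero>] basic(1)[of \<one>]
      basic(2)[of \<one> \<zero>]
    unfolding capped_count_def by (auto simp: add_0_left basic(3) split: if_splits)
  then show "occurs t m c \<longleftrightarrow> occurs t m' c" "repeats t m c \<longleftrightarrow> repeats t m' c" by auto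
qed

definition weight_upto :: "'a \<Rightarrow> 'a \<Rightarrow> 'a" where
  "weight_upto = prim_rec (\<lambda>p. \<zero>) (\<lambda>p n v. v \<oplus> capped_count (p1 p) (p2 p) n)"

lemma recf_weight_upto [recs]: "recf F \<Longrightarrow> recf G \<Longrightarrow> recf (\<lambda>x. weight_upto (F x) (G x))"
  unfolding weight_upto_def by (rule recf_comp2, rule prim_rec) (assumption | rule recs)+

lemma weight_upto:
  "weight_upto p \<zero> = \<zero>" "weight_upto p (n \<oplus> \<one>) = weight_upto p n \<oplus> capped_count (p1 p) (p2 p) n"
  unfolding weight_upto_def by (rule prim_rec; (rule recs)+)+

definition weight :: "'a \<Rightarrow> 'a \<Rightarrow> 'a" where
  "weight t m = weight_upto (pr t m) k"

lemma recf_weight [recs]: "recf F \<Longrightarrow> recf G \<Longrightarrow> recf (\<lambda>x. weight (F x) (G x))"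
  unfolding weight_def by (assumption | rule recs)+

lemma weight_mono: "t' \<preceq> t \<Longrightarrow> m \<preceq> m' \<Longrightarrow> weight t m \<preceq> weight t' m'"
  unfolding weight_def
  by (rule sums_mono(1)[where d = "capped_count t m" and d' = "capped_count t' m'"])
    (auto intro: recs capped_count_mono simp: weight_upto)

lemma weight_eq:
  "t' \<preceq> t \<Longrightarrow> m \<preceq> m' \<Longrightarrow> weight t m = weight t' m' \<Longrightarrow> c \<prec> k \<Longrightarrow> capped_count t m c = capped_count t' m' c"
  unfolding weight_def
  by (rule sums_mono(2)[where S = "weight_upto (pr t m)" and S' = "weight_upto (pr t' m')"])
    (auto intro: recs capped_count_mono simp: weight_upto)

lemma weight_bound: "weight t m \<preceq> k \<oplus> k"
proof -
  have "weight_upto p n \<preceq> n \<oplus> n" for p n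
  proof (rule rec_induct[where x = n])
    show "rec (\<lambda>n. weight_upto p n \<preceq> n \<oplus> n)" by (rule recs)+
    fix n assume "weight_upto p n \<preceq> n \<oplus> n"
    moreover have "capped_count (p1 p) (p2 p) n \<preceq> \<one> \<oplus> \<one>"
      unfolding capped_count_def by (intro arith.add_mono) auto
    ultimately have "weight_upto p (n \<oplus> \<one>) \<preceq> n \<oplus> n \<oplus> (\<one> \<oplus> \<one>)"
      unfolding weight_upto by (rule arith.add_mono)
    also have "\<dots> = n \<oplus> \<one> \<oplus> (n \<oplus> \<one>)" by (metis add_assoc add_comm)
    finally show "weight_upto p (n \<oplus> \<one>) \<preceq> n \<oplus> \<one> \<oplus> (n \<oplus> \<one>)" .
  qed (simp add: weight_upto)
  then show ?thesis by (simp add: weight_def)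
qed

definition next_start :: "'a \<Rightarrow> 'a \<Rightarrow> 'a" where
  "next_start t m = mu (\<lambda>u. ((\<exists>x. x \<prec> m \<and> single t m x) \<longrightarrow> (\<exists>x. x \<prec> u \<and> single t m x)) \<and>
     (\<not> (\<exists>x. x \<prec> m \<and> single t m x) \<longrightarrow> u = t))"

lemma recf_next_start [recs]: "recf F \<Longrightarrow> recf G \<Longrightarrow> recf (\<lambda>x. next_start (F x) (G x))"
proof (rule recf_comp2[where h = next_start])
  show "recf (\<lambda>z. next_start (p1 z) (p2 z))"
    unfolding next_start_def by (rule recf_mu) (intro recs, blast)
qed

lemma next_start_none: "(\<And>x. \<not> single t m x) \<Longrightarrow> next_start t m = t"
  unfolding next_start_def by (rule mu_eq) (auto simp: less_irrefl)

lemma next_start_single: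
  assumes "single t m x"
  obtains y where "next_start t m = y \<oplus> \<one>" "single t m y"
proof -
  define P where "P = (\<lambda>u. \<exists>x. x \<prec> u \<and> single t m x)"
  have ex: "\<exists>x. x \<prec> m \<and> single t m x" using assms unfolding single_def by blast
  then have next_start: "next_start t m = mu P" by (simp add: next_start_def P_def)
  have P: "rec P" unfolding P_def by (intro recs)
  have "P m" using ex by (simp add: P_def)
  from mu(1)[OF P this] obtain y where y: "y \<prec> next_start t m" "single t m y" unfolding next_start P_def by blast
  have "P (y \<oplus> \<one>)" using y(2) unfolding P_def by (auto simp: basic(8))
  then have "\<not> y \<oplus> \<one> \<prec> next_start t m" using mu(2)[OF P \<open>P m\<close>] unfolding next_start by blast
  then have "next_start t m = y \<oplus> \<one>" using y(1) succ_le arith.not_less arith.order.antisym by metis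
  then show ?thesis using that y(2) by blast
qed

text \<open>
  A single point of \<open>[t, m')\<close> lies below \<open>m\<close>: its value occurs in \<open>[t, m)\<close> because the capped counts agree,
  and there is only one occurrence. So both intervals have the same single points.
\<close>

lemma next_start_eq:
  assumes "m \<preceq> m'" and eq: "\<And>c. c \<prec> k \<Longrightarrow> capped_count t m c = capped_count t m' c"
  shows "next_start t m = next_start t m'"
proof -
  have single: "single t m x \<longleftrightarrow> single t m' x" for x
  proof
    assume x: "single t m x"
    then have "x \<prec> m'" using assms(1) arith.order.strict_trans2 unfolding single_def by blast
    then show "single t m' x"
      using x capped_count_eq(2)[OF eq[OF f_less] assms(1)] unfolding single_def by blast
  next
    assume x: "single t m' x"
    then have "occurs t m (f x)"
      using capped_count_eq(1)[OF eq[OF f_less] assms(1)] unfolding single_def occurs_def by blast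
    then obtain y where y: "y \<prec> m" "t \<preceq> y" "f y = f x" unfolding occurs_def by blast
    then have "y = x"
      using x repeatsI[of x m' y t "f x"] assms(1) arith.order.strict_trans2 unfolding single_def by blast
    then show "single t m x"
      using x y capped_count_eq(2)[OF eq[OF f_less] assms(1)] unfolding single_def by blast
  qed
  then have "(\<exists>x. x \<prec> m \<and> single t m x) \<longleftrightarrow> (\<exists>x. x \<prec> m' \<and> single t m' x)"
    unfolding single_def by blast
  then show ?thesis unfolding next_start_def single by simp
qed

text \<open>
  The value at the single point that is passed no longer occurs, whereas the other counts do not grow.
\<close>

lemma weight_next_start:
  assumes "single t m x"
  shows "weight (next_start t m) m \<prec> weight t m"
proof -
  obtain y where u: "next_start t m = y \<oplus> \<one>" and y: "single t m y" using next_start_single[OF assms] .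
  have le: "t \<preceq> y \<oplus> \<one>" using y less_succ[of y y] arith.order.trans[of t y "y \<oplus> \<one>"]
    unfolding single_def le_def by (metis basic(8))
  have no: "\<not> occurs (y \<oplus> \<one>) m (f y)"
  proof
    assume "occurs (y \<oplus> \<one>) m (f y)"
    then obtain z where "z \<prec> m" "y \<prec> z" "f z = f y" unfolding occurs_def succ_le by blast
    then show False using y unfolding single_def repeats_def by blast
  qed
  then have "capped_count (y \<oplus> \<one>) m (f y) = \<zero>"
    using repeats_occurs unfolding capped_count_def by (auto simp: basic(3))
  moreover have "capped_count t m (f y) \<noteq> \<zero>"
    using y unfolding capped_count_def single_def occurs_def by (auto simp: basic(1,3))
  ultimately have "weight (y \<oplus> \<one>) m \<noteq> weight t m"
    using weight_eq[OF le, of m m "f y"] f_less by auto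
  then show ?thesis using weight_mono[OF le, of m m] u by (simp add: le_def)
qed

definition chain :: "'a \<Rightarrow> 'a \<Rightarrow> 'a" where
  "chain = prim_rec (\<lambda>m. \<zero>) (\<lambda>m i t. next_start t m)"

lemma recf_chain [recs]: "recf F \<Longrightarrow> recf G \<Longrightarrow> recf (\<lambda>x. chain (F x) (G x))"
  unfolding chain_def by (rule recf_comp2, rule prim_rec) (assumption | rule recs)+

lemma chain: "chain m \<zero> = \<zero>" "chain m (i \<oplus> \<one>) = next_start (chain m i) m"
  unfolding chain_def by (rule prim_rec; (rule recs)+)+

definition base :: 'a where "base = k \<oplus> k \<oplus> \<one>"

text \<open>
  The weights met during the first \<open>i\<close> steps of the search, as digits in base \<open>2k + 1\<close> with the earliest one
  most significant, so that the order of the codes is the lexicographic order.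
\<close>

definition code :: "'a \<Rightarrow> 'a \<Rightarrow> 'a" where
  "code = prim_rec (\<lambda>m. \<zero>) (\<lambda>m i v. v \<otimes> base \<oplus> weight (chain m i) m)"

lemma recf_code [recs]: "recf F \<Longrightarrow> recf G \<Longrightarrow> recf (\<lambda>x. code (F x) (G x))"
  unfolding code_def by (rule recf_comp2, rule prim_rec) (assumption | rule recs)+

lemma code: "code m \<zero> = \<zero>" "code m (i \<oplus> \<one>) = code m i \<otimes> base \<oplus> weight (chain m i) m"
  unfolding code_def by (rule prim_rec; (rule recs)+)+

lemma code_step_less: "v \<otimes> base \<oplus> weight t m \<prec> (v \<oplus> \<one>) \<otimes> base"
proof -
  have "weight t m \<prec> base" using weight_bound by (simp add: base_def less_succ)
  then show ?thesis by (simp add: succ_mult)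
qed

text \<open>
  The bound is \<open>(2k + 1)\<^sup>i\<close>, a power with a possibly nonstandard exponent.
\<close>

lemma code_bounded: "\<exists>w. \<forall>m. code m i \<preceq> w"
proof -
  define w where "w = prim_rec (\<lambda>p. \<one>) (\<lambda>p i v. v \<otimes> base)"
  have w: "recf (\<lambda>z. w (p1 z) (p2 z))" "w p \<zero> = \<one>" "w p (i \<oplus> \<one>) = w p i \<otimes> base" for p i
    unfolding w_def by (rule prim_rec; (rule recs)+)+
  have "code m i \<prec> w \<zero> i" for m
  proof (rule rec_induct[where x = i])
    show "rec (\<lambda>i. code m i \<prec> w \<zero> i)" by (rule recs recf_comp2[OF w(1)])+
  next
    fix i assume "code m i \<prec> w \<zero> i"
    then have "(code m i \<oplus> \<one>) \<otimes> base \<preceq> w \<zero> i \<otimes> base"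
      by (intro arith.mult_right_mono) (simp_all add: succ_le)
    then show "code m (i \<oplus> \<one>) \<prec> w \<zero> (i \<oplus> \<one>)"
      unfolding code w using code_step_less arith.order.strict_trans2 by blast
  qed (simp add: code w)
  then show ?thesis unfolding le_def by blast
qed

text \<open>
  If the codes and starting points agree after \<open>i\<close> steps, a larger stage has the same or a larger next digit. In
  the first case all capped counts agree and the searches stay together; in the second the code is larger, and no
  later digits can make up for that.
\<close>

lemma code_mono:
  assumes "m \<preceq> m'"
  shows "code m i \<prec> code m' i \<or> code m i = code m' i \<and> chain m i = chain m' i"
proof (rule rec_induct[where x = i])
  show "rec (\<lambda>i. code m i \<prec> code m' i \<or> code m i = code m' i \<and> chain m i = chain m' i)"
    by (rule recs)+
next
  fix i assume "code m i \<prec> code m' i \<or> code m i = code m' i \<and> chain m i = chain m' i"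
  then show "code m (i \<oplus> \<one>) \<prec> code m' (i \<oplus> \<one>) \<or>
      code m (i \<oplus> \<one>) = code m' (i \<oplus> \<one>) \<and> chain m (i \<oplus> \<one>) = chain m' (i \<oplus> \<one>)"
  proof
    assume "code m i \<prec> code m' i"
    then have "(code m i \<oplus> \<one>) \<otimes> base \<preceq> code m' i \<otimes> base"
      by (intro arith.mult_right_mono) (simp_all add: succ_le)
    also have "\<dots> \<preceq> code m' (i \<oplus> \<one>)" unfolding code by simp
    finally have "code m (i \<oplus> \<one>) \<prec> code m' (i \<oplus> \<one>)"
      unfolding code(2)[of m] using code_step_less arith.order.strict_trans2 by blast
    then show ?thesis ..
  next
    assume eq: "code m i = code m' i \<and> chain m i = chain m' i"
    have "weight (chain m i) m \<preceq> weight (chain m i) m'" using assms by (intro weight_mono) simp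
    then consider "weight (chain m i) m \<prec> weight (chain m i) m'" |
      "weight (chain m i) m = weight (chain m i) m'" unfolding le_def by blast
    then show ?thesis
    proof cases
      case 1
      then show ?thesis using eq by (simp add: code)
    next
      case 2
      then have "next_start (chain m i) m = next_start (chain m i) m'"
        using assms weight_eq by (intro next_start_eq) auto
      then show ?thesis using eq 2 by (simp add: code chain)
    qed
  qed
qed (simp add: code chain)

text \<open>
  As long as single points exist, each step costs at least 1 of a weight that is initially at most \<open>2k\<close>.
\<close>

lemma chain_end: "\<not> single (chain m base) m x"
proof -
  have "weight (chain m i) m \<oplus> i \<preceq> k \<oplus> k \<or> (\<forall>x. x \<prec> m \<longrightarrow> \<not> single (chain m i) m x)" for i
  proof (rule rec_induct[where x = i])
    show "rec (\<lambda>i. weight (chain m i) m \<oplus> i \<preceq> k \<oplus> k \<or> (\<forall>x. x \<prec> m \<longrightarrow> \<not> single (chain m i) m x))"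
      by (intro recs)
    show "weight (chain m \<zero>) m \<oplus> \<zero> \<preceq> k \<oplus> k \<or> (\<forall>x. x \<prec> m \<longrightarrow> \<not> single (chain m \<zero>) m x)"
      using weight_bound by (simp add: basic(3))
  next
    fix i assume IH: "weight (chain m i) m \<oplus> i \<preceq> k \<oplus> k \<or> (\<forall>x. x \<prec> m \<longrightarrow> \<not> single (chain m i) m x)"
    show "weight (chain m (i \<oplus> \<one>)) m \<oplus> (i \<oplus> \<one>) \<preceq> k \<oplus> k \<or>
      (\<forall>x. x \<prec> m \<longrightarrow> \<not> single (chain m (i \<oplus> \<one>)) m x)"
    proof (cases "\<exists>x. single (chain m i) m x")
      case True
      then obtain x where x: "single (chain m i) m x" by blast
      have "weight (chain m (i \<oplus> \<one>)) m \<oplus> (i \<oplus> \<one>) = weight (next_start (chain m i) m) m \<oplus> \<one> \<oplus> i"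
        unfolding chain by (metis add_assoc add_comm)
      also have "\<dots> \<preceq> weight (chain m i) m \<oplus> i"
        using weight_next_start[OF x] by (simp add: succ_le)
      also have "\<dots> \<preceq> k \<oplus> k" using IH x unfolding single_def by blast
      finally show ?thesis ..
    next
      case False
      then show ?thesis using next_start_none by (simp add: chain)
    qed
  qed
  from this[of base] have "\<forall>x. x \<prec> m \<longrightarrow> \<not> single (chain m base) m x"
  proof
    assume "weight (chain m base) m \<oplus> base \<preceq> k \<oplus> k"
    moreover have "base \<preceq> weight (chain m base) m \<oplus> base" by simp
    ultimately have "k \<oplus> k \<oplus> \<one> \<preceq> k \<oplus> k" using arith.order.trans unfolding base_def by blast
    then show ?thesis using less_irrefl by (simp add: succ_le)
  qed
  then show ?thesis unfolding single_def by blast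
qed

theorem repeating_tail: "\<exists>b. \<forall>x. b \<preceq> x \<longrightarrow> (\<exists>y. b \<preceq> y \<and> x \<noteq> y \<and> f x = f y)"
proof -
  have "recf (\<lambda>m. code m base)" by (rule recs)+
  then obtain M where M: "\<And>m. code m base \<preceq> code M base"
    using bounded_max code_bounded by metis
  define b where "b = chain M base"
  have b: "chain m base = b" if "M \<preceq> m" for m
    using code_mono[OF that, of base] M[of m] arith.not_less unfolding b_def by metis
  have "\<exists>y. b \<preceq> y \<and> x \<noteq> y \<and> f x = f y" if x: "b \<preceq> x" for x
  proof -
    \<comment> \<open>A stage that is late enough for the search to end at \<open>b\<close> and whose interval contains \<open>x\<close>.\<close>
    define m where "m = M \<oplus> x \<oplus> \<one>"
    have "M \<preceq> m" "x \<prec> m"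
    proof -
      have "m = M \<oplus> (x \<oplus> \<one>)" "m = x \<oplus> (M \<oplus> \<one>)" unfolding m_def by (metis add_assoc add_comm)+
      then show "M \<preceq> m" "x \<prec> m" using le_iff less_iff by blast+
    qed
    then have "repeats b m (f x)" using chain_end[of m x] b x by (simp add: single_def)
    then obtain y z where yz: "z \<prec> y" "b \<preceq> z" "f z = f x" "f y = f x" unfolding repeats_def by blast
    then have "b \<preceq> y" using arith.order.trans unfolding le_def[of z y] le_def[of b] using less_trans by blast
    then show ?thesis using yz less_irrefl by (cases "x = z") auto
  qed
  then show ?thesis by blast
qed

end

section \<open>Truth of the principle in every model\<close>

context rca0_model
begin

lemma sat_function_into:
  "sat e E function_into \<longleftrightarrow> (\<forall>z. z \<in> E 0 \<longrightarrow> (\<exists>i j. j \<prec> e 0 \<and> z = pr i j)) \<and>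
     (\<forall>i. \<exists>j. pr i j \<in> E 0) \<and> (\<forall>i j j'. pr i j \<in> E 0 \<longrightarrow> pr i j' \<in> E 0 \<longrightarrow> j = j')"
  unfolding function_into_def sat_And sat.simps(6) sat_ExN sat.simps(5)[of _ _ "Mem t X" for t X] by simp

lemma sat_same_value: "sat e E same_value \<longleftrightarrow> (\<exists>j. pr (e 0) j \<in> E 0 \<and> pr (e 1) j \<in> E 0)"
  unfolding same_value_def sat_ExN sat_And by simp

lemma sat_Leq: "sat e E (Leq s t) \<longleftrightarrow> val e s \<preceq> val e t"
  by (auto simp: le_def)

lemma valid_ERT: "valid ERT"
proof -
  have "\<exists>b. \<forall>x. b \<preceq> x \<longrightarrow> (\<exists>y. b \<preceq> y \<and> x \<noteq> y \<and> (\<exists>j. pr y j \<in> X \<and> pr x j \<in> X))"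
    if X: "X \<in> sets" and "sat (k ## e) (X ## E) function_into" for X k e E
  proof -
    have pairs: "\<exists>i j. j \<prec> k \<and> z = pr i j" if "z \<in> X" for z
      using \<open>sat (k ## e) (X ## E) function_into\<close> that unfolding sat_function_into nat.case by blast
    have total: "\<exists>j. pr i j \<in> X" for i
      using \<open>sat (k ## e) (X ## E) function_into\<close> unfolding sat_function_into nat.case by blast
    have unique: "j = j'" if "pr i j \<in> X" "pr i j' \<in> X" for i j j'
      using \<open>sat (k ## e) (X ## E) function_into\<close> that unfolding sat_function_into nat.case by blast
    define f where "f i = (THE j. pr i j \<in> X)" for i
    have f: "pr i j \<in> X \<longleftrightarrow> f i = j" for i j
      using total[of i] unique[of i] unfolding f_def by (metis the_equality)
    have "z \<in> X \<longleftrightarrow> z \<in> graph f" for z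
      using pairs[of z] f by (auto simp: graph_def)
    then have "X = graph f" by blast
    then have "recf f" using X by (simp add: recf_def)
    moreover have "f x \<prec> k" for x using pairs[of "pr x (f x)"] f by auto
    ultimately interpret coloring zero one plus times less sets f k by unfold_locales
    show ?thesis using repeating_tail unfolding f by metis
  qed
  note main = this
  show ?thesis
    unfolding valid_def
  proof (intro allI impI)
    fix e and E :: "nat \<Rightarrow> 'a set"
    let ?p = "ExN (AllN (Imp (Leq (Var 1) (Var 0)) (ExN (And (Leq (Var 2) (Var 0))
      (And (Neg (Eq (Var 1) (Var 0))) same_value)))))"
    have "sat (k ## e) (X ## E) function_into \<longrightarrow> sat (k ## e) (X ## E) ?p" if "X \<in> sets" for k X
    proof
      assume "sat (k ## e) (X ## E) function_into"
      from main[OF that this] show "sat (k ## e) (X ## E) ?p"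
        unfolding sat_ExN sat_And sat.simps(6) sat.simps(5)[of _ _ "Leq s t" for s t] sat_Leq
          sat_same_value by simp
    qed
    then show "sat e E ERT" unfolding ERT_def sat.simps(5)[of _ _ function_into] sat.simps(6,7) by blast
  qed
qed

end

theorem theorem3: "RCA0 \<turnstile> ERT"
proof (rule completeness)
  show "basic_axioms \<subseteq> RCA0" by (auto simp: RCA0_def)
next
  fix zero one :: nat and plus times less sets
  assume "sets \<noteq> {}" and "\<And>q. q \<in> RCA0 \<Longrightarrow> so_structure.valid zero one plus times less sets q"
  then interpret rca0_model zero one plus times less sets by unfold_locales
  show "so_structure.valid zero one plus times less sets ERT" by (rule valid_ERT)
qed

end
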